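(* Let $t$ be an injective-reachable quantum seed and let $\mathrm{A}(t)$ be a $\Bbbk$-subalgebra of the upper quantum cluster algebra $\mathcal{U}_q(t)$. Assume that $\mathrm{A}(t)$ has the common triangular basis $\mathbf{L}$. Then, for any $V\in\mathbf{L}$ and any localized quantum cluster monomial $R$, either $R*V\in v^{\mathbb{Z}}\mathbf{L}$ or $$R*V=v^{s}S+\sum_{j}b_{j}L^{(j)}+v^{h}H,$$ where $s>h$ are integers, $b_{j}\in v^{h+1}\mathbb{Z}[v]\cap v^{s-1}\mathbb{Z}[v^{-1}]$ for all $j$, and $S,L^{(j)},H$ are finitely many distinct elements of $\mathbf{L}$.
   Context: **Quantum seeds.** Let $v=q^{1/2}$ be a formal parameter, $\Bbbk=\mathbb{Z}[v^{\pm1}]$, $\mathbf{m}=v^{-1}\mathbb{Z}[v^{-1}]$, $[a]_+=\max(a,0)$ (componentwise on vectors). Fix a finite set $I=I_{\mathrm{uf}}\sqcup I_{\mathrm{f}}$ (unfrozen and frozen vertices). A quantum seed $t=(\widetilde B(t),\Lambda(t),(X_i(t))_{i\in I})$ consists of an integer matrix $\widetilde B(t)=(b_{ij}(t))_{i\in I,j\in I_{\mathrm{uf}}}$, a skew-symmetric integer matrix $\Lambda(t)=(\Lambda_{ij}(t))_{i,j\in I}$ and indeterminates $X_i(t)$, such that $(\widetilde B(t)^T\Lambda(t))_{kj}=\delta_{kj}d_k$ for $k\in I_{\mathrm{uf}},j\in I$, for some positive integers $d_k$. Put $M^\circ(t)=\mathbb{Z}^I$ with unit vectors $f_i(t)$,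 $N_{\mathrm{uf}}(t)=\mathbb{Z}^{I_{\mathrm{uf}}}$, $N_{\mathrm{uf}}^{\ge0}(t)=\mathbb{N}^{I_{\mathrm{uf}}}$, $p^*n=\widetilde B(t)n$ for $n\in N_{\mathrm{uf}}(t)$, and $\lambda(g,g')=g^T\Lambda(t)g'$. Let $\mathcal{LP}(t)$ be the free $\Bbbk$-module with basis $X(t)^m$, $m\in M^\circ(t)$, where $X(t)^{f_i(t)}=X_i(t)$; it has the commutative product $X^m\cdot X^{m'}=X^{m+m'}$ and the twisted product $X^m*X^{m'}=v^{\lambda(m,m')}X^{m+m'}$. Its algebra structure is $(+,* )$ unless otherwise specified; $\mathcal F(t)$ is its skew field of fractions. The bar involution is $v\mapsto v^{-1}$, $X(t)^m\mapsto X(t)^m$. **Mutations.** For $k\in I_{\mathrm{uf}}$, $t'=\mu_kt$ has $b'_{ij}=-b_{ij}$ if $k\in\{i,j\}$ and $b'_{ij}=b_{ij}+[b_{ik}]_+[b_{kj}]_+-[-b_{ik}]_+[-b_{kj}]_+$ otherwise; $\Lambda'$ is skew-symmetric with $\Lambda'_{ij}=\Lambda_{ij}$ for $i,j\ne k$ and $\Lambda'_{kj}=\lambda(-f_k+\sum_i[-b_{ik}]_+f_i,f_j)$ for $j\neq k$. There is an isomorphism $\mu_k^*:\mathcal F(t')\to\mathcal F(t)$ with $\mu_k^*X_i(t')=X_i(t)$ for $i\ne k$ and $\mu_k^*X_k(t')=X(t)^{-f_k+\sum_j[-b_{jk}]_+f_j}+X(t)^{-f_k+\sum_i[b_{ik}]_+f_i}$.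 $\Delta^+$ denotes the set of all seeds obtained from $t$ by iterated mutations. For $t,t'\in\Delta^+$, composing along a mutation sequence from $t$ to $t'$ gives $\mu_{t',t}^*:\mathcal F(t')\to\mathcal F(t)$, independent of the sequence. Upper quantum cluster algebra: $\mathcal U_q(t)=\bigcap_{t'\in\Delta^+}\mu_{t',t}^*\mathcal{LP}(t')$. Quantum cluster monomials in $t'$ are the elements $\mu_{t',t}^*X(t')^m$, $m\in\mathbb{N}^I$; localized quantum cluster monomials are $\mu_{t',t}^*X(t')^m$ with $t'\in\Delta^+$, $m\in\mathbb{N}^{I_{\mathrm{uf}}}\oplus\mathbb{Z}^{I_{\mathrm f}}$. **Degrees.** For $g,g'\in M^\circ(t)$, $g'\preceq_tg$ iff $g'=g+p^*n$ for some $n\in N_{\mathrm{uf}}^{\ge0}(t)$. An element $Z=\sum b_mX(t)^m\in\mathcal{LP}(t)$ has degree $g=\deg^tZ$ if $g$ is the unique $\prec_t$-maximal element of $\{m\mid b_m\ne0\}$; it is $g$-pointed if moreover $b_g=1$. If $Z$ has degree $g$, $[Z]^t:=b_g^{-1}Z$. **Tropical transformation.** For $t'=\mu_kt$, $\phi_{t',t}:M^\circ(t)\to M^\circ(t')$ sends $g$ to $g'$ with $g'_k=-g_k$, and for $i\neq k$, $g'_i=g_i+b_{ik}(t)[g_k]_+$ if $b_{ik}(t)\ge0$, $g'_i=g_i+b_{ik}(t)[-g_k]_+$ if $b_{ik}(t)<0$. In general $\phi_{t',t}$ is the composition along a mutation sequence from $t$ to $t'$ (independent of choice). **Injective-reachability.**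 $t$ is injective-reachable if there are a seed $t[1]\in\Delta^+$ and a permutation $\sigma$ of $I_{\mathrm{uf}}$ with $b_{\sigma i,\sigma j}(t[1])=b_{ij}(t)$ for $i,j\in I_{\mathrm{uf}}$ and $\deg^t\mu_{t[1],t}^*X_{\sigma k}(t[1])\in-f_k(t)+\mathbb{Z}^{I_{\mathrm f}}$ for all $k\in I_{\mathrm{uf}}$. ($t[1]$ is unique up to relabelling; if $t$ is injective-reachable, so are all seeds of $\Delta^+$.) **Bases.** Let $\mathrm A(t)\subset\mathcal U_q(t)$ be a $\Bbbk$-subalgebra and $\mathrm A(t')=\mu_{t,t'}^*\mathrm A(t)$. A $\Bbbk$-basis $\mathbf L$ of $\mathrm A(t)$ is the triangular basis with respect to $t$ if: (1) $X_i(t)\in\mathbf L$ for $i\in I$; (2) every element of $\mathbf L$ is bar-invariant; (3) $\mathbf L=\{\mathbf L_g\mid g\in M^\circ(t)\}$ with $\mathbf L_g$ $g$-pointed; (4) for all $g$ and $i\in I$, $[X_i(t)*\mathbf L_g]^t=\sum_{g'\preceq_tg+f_i}b_{g'}\mathbf L_{g'}$ with $b_{g+f_i}=1$ and $b_{g'}\in\mathbf m$ for $g'\prec_tg+f_i$; (5) $\mathbf L$ contains the quantum cluster monomials in $t$ and in $t[1]$. (It is unique if it exists.) The triangular basis $\mathbf L$ of $\mathrm A(t)$ with respect to $t$ is the common triangular basis if, for every $t'\in\Delta^+$, $\mu_{t,t'}^*\mathbf L$ is the triangular basis of $\mathrm A(t')$ with respect to $t'$, and $\mu_{t,t'}^*\mathbf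 L_g$ is $\phi_{t',t}(g)$-pointed in $\mathcal{LP}(t')$ for every $g$. *)

theory Defs
  imports
    "HOL-Analysis.Finite_Cartesian_Product"
    "HOL-Library.Poly_Mapping"
    "HOL-Combinatorics.Permutations"
begin

section \<open>Laurent polynomials\<close>

text \<open>
  The coefficient ring \<open>\<int>[v, v\<^sup>-\<^sup>1]\<close> is the group ring of \<open>\<int>\<close> over \<open>\<int>\<close>, that is,
  \<open>int \<Rightarrow>\<^sub>0 int\<close> with the convolution product of \<^theory>\<open>HOL-Library.Poly_Mapping\<close>.
  The vertex set is a finite type \<open>'i\<close>, and \<open>\<int>\<^sup>I\<close> is \<open>int ^ 'i\<close> with unit vectors \<open>axis i 1\<close>.
\<close>

type_synonym zv = "int \<Rightarrow>\<^sub>0 int"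
type_synonym 'i lp = "(int ^ 'i) \<Rightarrow>\<^sub>0 zv"

definition vpow :: "int \<Rightarrow> zv" where
  "vpow n = Poly_Mapping.single n 1"

definition zv_le :: "int \<Rightarrow> zv set" where  \<comment> \<open>\<open>v\<^sup>n \<int>[v\<^sup>-\<^sup>1]\<close>\<close>
  "zv_le n = {p. Poly_Mapping.keys p \<subseteq> {..n}}"

definition zv_ge :: "int \<Rightarrow> zv set" where  \<comment> \<open>\<open>v\<^sup>n \<int>[v]\<close>\<close>
  "zv_ge n = {p. Poly_Mapping.keys p \<subseteq> {n..}}"

definition lam_form :: "int ^ 'i ^ 'i \<Rightarrow> int ^ 'i \<Rightarrow> int ^ 'i \<Rightarrow> int" where
  "lam_form \<Lambda> g g' = (\<Sum>i\<in>UNIV. \<Sum>j\<in>UNIV. g $ i * \<Lambda> $ i $ j * g' $ j)"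

text \<open>The twisted product, determined by \<open>X\<^sup>m * X\<^sup>m' = v\<^sup>\<lambda>\<^sup>(\<^sup>m\<^sup>,\<^sup>m\<^sup>'\<^sup>) X\<^sup>m\<^sup>+\<^sup>m\<^sup>'\<close>.  The class product of
  the type \<open>'i lp\<close> is the commutative one.\<close>

definition twisted_mult :: "int ^ 'i ^ 'i \<Rightarrow> 'i lp \<Rightarrow> 'i lp \<Rightarrow> 'i lp" where
  "twisted_mult \<Lambda> P Q =
     (\<Sum>m\<in>Poly_Mapping.keys P. \<Sum>m'\<in>Poly_Mapping.keys Q.
        Poly_Mapping.single (m + m')
          (vpow (lam_form \<Lambda> m m') * Poly_Mapping.lookup P m * Poly_Mapping.lookup Q m'))"

definition bar :: "'i lp \<Rightarrow> 'i lp" where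
  "bar = Poly_Mapping.map (Poly_Mapping.map_key uminus)"

section \<open>Quantum seeds\<close>

text \<open>
  Let \<open>F\<close> be the skew field of fractions of the quantum torus of an initial seed \<open>t\<^sub>0\<close>; it is
  any division ring \<open>'k\<close> with the defining property \<open>skew_field_of_fractions\<close> below.  The
  skew fields of all seeds obtained by mutation are identified with \<open>F\<close> along the isomorphisms
  \<open>\<mu>\<^sup>*\<close>, so a seed \<open>t\<close> comes with the image \<open>vq t\<close> of \<open>v\<close> in \<open>F\<close> and
  with the images \<open>tmon t m\<close> of the Laurent monomials \<open>X(t)\<^sup>m\<close>, which for \<open>t \<in> \<Delta>\<^sup>+\<close> are the
  elements \<open>\<mu>\<^sup>*\<^bsub>t,t\<^sub>0\<^esub> X(t)\<^sup>m\<close>.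

  The \<open>I \<times> I\<^sub>u\<^sub>f\<close> matrix \<open>B\<close> is stored as an \<open>I \<times> I\<close> matrix whose frozen columns vanish.
\<close>

record ('i, 'k) qseed =
  uf :: "'i set"
  bmat :: "int ^ 'i ^ 'i"
  lam :: "int ^ 'i ^ 'i"
  vq :: "'k"
  tmon :: "int ^ 'i \<Rightarrow> 'k"

definition coef :: "('i::finite, 'k::division_ring) qseed \<Rightarrow> zv \<Rightarrow> 'k" where
  "coef t p = (\<Sum>n\<in>Poly_Mapping.keys p. of_int (Poly_Mapping.lookup p n) * vq t powi n)"

text \<open>The map \<open>\<LL>\<P>(t) \<rightarrow> F\<close>, which for \<open>t \<in> \<Delta>\<^sup>+\<close> is the restriction of \<open>\<mu>\<^sup>*\<^bsub>t,t\<^sub>0\<^esub>\<close>.\<close>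

definition emb :: "('i::finite, 'k::division_ring) qseed \<Rightarrow> 'i lp \<Rightarrow> 'k" where
  "emb t P = (\<Sum>m\<in>Poly_Mapping.keys P. coef t (Poly_Mapping.lookup P m) * tmon t m)"

abbreviation LP :: "('i::finite, 'k::division_ring) qseed \<Rightarrow> 'k set" where
  "LP t \<equiv> range (emb t)"

text \<open>\<open>emb t\<close> is an embedding of rings \<open>(\<LL>\<P>(t), +, *) \<rightarrow> F\<close> (additivity holds by definition), and
  every element of \<open>F\<close> is a fraction.\<close>

definition skew_field_of_fractions :: "('i::finite, 'k::division_ring) qseed \<Rightarrow> bool" where
  "skew_field_of_fractions t \<longleftrightarrow>
     inj (emb t) \<and> emb t 1 = 1 \<and>
     (\<forall>P Q. emb t (twisted_mult (lam t) P Q) = emb t P * emb t Q) \<and>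
     (\<forall>x. \<exists>P Q. Q \<noteq> 0 \<and> x = emb t P * inverse (emb t Q))"

definition quantum_seed :: "('i::finite, 'k::division_ring) qseed \<Rightarrow> bool" where
  "quantum_seed t \<longleftrightarrow>
     (\<forall>i j. j \<notin> uf t \<longrightarrow> bmat t $ i $ j = 0) \<and>
     (\<forall>i j. lam t $ j $ i = - (lam t $ i $ j)) \<and>
     (\<exists>d :: 'i \<Rightarrow> int. \<forall>k\<in>uf t. 0 < d k \<and>
        (\<forall>j. (Finite_Cartesian_Product.transpose (bmat t) ** lam t) $ k $ j = (if k = j then d k else 0))) \<and>
     skew_field_of_fractions t"

section \<open>Mutations\<close>

abbreviation pos :: "int \<Rightarrow> int" where
  "pos a \<equiv> max a 0"

definition mut_bmat :: "'i::finite \<Rightarrow> int ^ 'i ^ 'i \<Rightarrow> int ^ 'i ^ 'i" where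
  "mut_bmat k B =
     (\<chi> i j. if k = i \<or> k = j then - (B $ i $ j)
            else B $ i $ j + pos (B $ i $ k) * pos (B $ k $ j)
                           - pos (- (B $ i $ k)) * pos (- (B $ k $ j)))"

definition exp_minus :: "'i::finite \<Rightarrow> int ^ 'i ^ 'i \<Rightarrow> int ^ 'i" where
  "exp_minus k B = - axis k 1 + (\<chi> i. pos (- (B $ i $ k)))"

definition exp_plus :: "'i::finite \<Rightarrow> int ^ 'i ^ 'i \<Rightarrow> int ^ 'i" where
  "exp_plus k B = - axis k 1 + (\<chi> i. pos (B $ i $ k))"

definition mut_lam :: "'i::finite \<Rightarrow> int ^ 'i ^ 'i \<Rightarrow> int ^ 'i ^ 'i \<Rightarrow> int ^ 'i ^ 'i" where
  "mut_lam k B \<Lambda> =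
     (\<chi> i j. if i = k \<and> j = k then 0
            else if i = k then lam_form \<Lambda> (exp_minus k B) (axis j 1)
            else if j = k then - lam_form \<Lambda> (exp_minus k B) (axis i 1)
            else \<Lambda> $ i $ j)"

text \<open>\<open>\<mu>\<^sub>k\<^sup>* X\<^sub>k(\<mu>\<^sub>k t)\<close>\<close>

definition new_var :: "'i \<Rightarrow> ('i::finite, 'k::division_ring) qseed \<Rightarrow> 'k" where
  "new_var k t = tmon t (exp_minus k (bmat t)) + tmon t (exp_plus k (bmat t))"

text \<open>
  The image of a Laurent monomial under \<open>\<mu>\<^sub>k\<^sup>*\<close> is forced by multiplicativity: with
  \<open>m = m\<degree> + m\<^sub>k f\<^sub>k\<close> one has \<open>X(t')\<^sup>m = v\<^sup>-\<^sup>\<lambda>\<^sup>'\<^sup>(\<^sup>m\<degree>\<^sup>,\<^sup> \<^sup>m\<^sub>k\<^sup>f\<^sub>k\<^sup>) X(t')\<^sup>m\<degree> * X\<^sub>k(t')\<^sup>m\<^sub>k\<close> in the quantum torus of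
  \<open>t' = \<mu>\<^sub>k t\<close>, and \<open>\<mu>\<^sub>k\<^sup>*\<close> maps \<open>X(t')\<^sup>m\<degree>\<close> to \<open>X(t)\<^sup>m\<degree>\<close> since \<open>m\<degree>\<close> has no \<open>k\<close>-component.
\<close>

definition mutate :: "'i \<Rightarrow> ('i::finite, 'k::division_ring) qseed \<Rightarrow> ('i, 'k) qseed" where
  "mutate k t = t
     \<lparr> bmat := mut_bmat k (bmat t),
       lam := mut_lam k (bmat t) (lam t),
       tmon := (\<lambda>m. let mk = axis k (m $ k); m0 = m - mk in
          vq t powi (- lam_form (mut_lam k (bmat t) (lam t)) m0 mk)
            * tmon t m0 * new_var k t powi (m $ k)) \<rparr>"

fun mutate_seq :: "'i list \<Rightarrow> ('i::finite, 'k::division_ring) qseed \<Rightarrow> ('i, 'k) qseed" where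
  "mutate_seq [] t = t"
| "mutate_seq (k # ks) t = mutate_seq ks (mutate k t)"

definition Delta_plus :: "('i::finite, 'k::division_ring) qseed \<Rightarrow> ('i, 'k) qseed set" where
  "Delta_plus t = {mutate_seq ks t | ks. set ks \<subseteq> uf t}"

definition trop :: "'i::finite \<Rightarrow> int ^ 'i ^ 'i \<Rightarrow> int ^ 'i \<Rightarrow> int ^ 'i" where
  "trop k B g =
     (\<chi> i. if i = k then - (g $ k)
          else if B $ i $ k \<ge> 0 then g $ i + B $ i $ k * pos (g $ k)
          else g $ i + B $ i $ k * pos (- (g $ k)))"

text \<open>The tropical transformation along a mutation sequence.\<close>

fun trop_seq :: "'i list \<Rightarrow> ('i::finite, 'k::division_ring) qseed \<Rightarrow> int ^ 'i \<Rightarrow> int ^ 'i" where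
  "trop_seq [] t g = g"
| "trop_seq (k # ks) t g = trop_seq ks (mutate k t) (trop k (bmat t) g)"

definition upper_cluster_algebra :: "('i::finite, 'k::division_ring) qseed \<Rightarrow> 'k set" where
  "upper_cluster_algebra t = (\<Inter>t'\<in>Delta_plus t. LP t')"

definition cluster_monomials_in :: "('i::finite, 'k::division_ring) qseed \<Rightarrow> 'k set" where
  "cluster_monomials_in t = {tmon t m | m. \<forall>i. 0 \<le> m $ i}"

definition localized_cluster_monomials :: "('i::finite, 'k::division_ring) qseed \<Rightarrow> 'k set" where
  "localized_cluster_monomials t =
     {tmon t' m | t' m. t' \<in> Delta_plus t \<and> (\<forall>i\<in>uf t. 0 \<le> m $ i)}"

lemma tmon_mutate:
  "tmon (mutate k t) m =
     vq t powi (- lam_form (mut_lam k (bmat t) (lam t)) (m - axis k (m $ k)) (axis k (m $ k)))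
       * tmon t (m - axis k (m $ k)) * new_var k t powi (m $ k)"
  by (simp add: mutate_def Let_def)

lemma mutate_tmon_axis_other:
  fixes t :: "('i::finite, 'k::division_ring) qseed"
  assumes "i \<noteq> k"
  shows "tmon (mutate k t) (axis i 1) = tmon t (axis i 1)"
proof -
  have k: "(axis i 1 :: int ^ 'i) $ k = 0"
    using assms by (simp add: axis_def)
  have z: "axis k 0 = (0 :: int ^ 'i)"
    by (simp add: axis_def vec_eq_iff)
  show ?thesis
    unfolding tmon_mutate k z by (simp add: lam_form_def)
qed

lemma mutate_tmon_axis_same:
  assumes "quantum_seed t"
  shows "tmon (mutate k t) (axis k 1) = new_var k t"
proof -
  have "emb t 1 = 1"
    using assms by (simp add: quantum_seed_def skew_field_of_fractions_def)
  then have "tmon t 0 = 1"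
    by (simp add: emb_def coef_def)
  then show ?thesis
    by (simp add: mutate_def Let_def lam_form_def)
qed

section \<open>Degrees\<close>

definition dom_le :: "('i::finite, 'k) qseed \<Rightarrow> int ^ 'i \<Rightarrow> int ^ 'i \<Rightarrow> bool" where
  "dom_le t g' g \<longleftrightarrow>
     (\<exists>n. (\<forall>i. 0 \<le> n $ i) \<and> (\<forall>i. i \<notin> uf t \<longrightarrow> n $ i = 0) \<and> g' = g + bmat t *v n)"

definition dom_less :: "('i::finite, 'k) qseed \<Rightarrow> int ^ 'i \<Rightarrow> int ^ 'i \<Rightarrow> bool" where
  "dom_less t g' g \<longleftrightarrow> dom_le t g' g \<and> g' \<noteq> g"

definition lp_has_degree :: "('i::finite, 'k) qseed \<Rightarrow> 'i lp \<Rightarrow> int ^ 'i \<Rightarrow> bool" where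
  "lp_has_degree t P g \<longleftrightarrow>
     {m \<in> Poly_Mapping.keys P. \<forall>m'\<in>Poly_Mapping.keys P. \<not> dom_less t m m'} = {g}"

definition has_degree :: "('i::finite, 'k::division_ring) qseed \<Rightarrow> 'k \<Rightarrow> int ^ 'i \<Rightarrow> bool" where
  "has_degree t Z g \<longleftrightarrow> (\<exists>P. emb t P = Z \<and> lp_has_degree t P g)"

definition pointed :: "('i::finite, 'k::division_ring) qseed \<Rightarrow> int ^ 'i \<Rightarrow> 'k \<Rightarrow> bool" where
  "pointed t g Z \<longleftrightarrow>
     (\<exists>P. emb t P = Z \<and> lp_has_degree t P g \<and> Poly_Mapping.lookup P g = 1)"

definition bar_invariant :: "('i::finite, 'k::division_ring) qseed \<Rightarrow> 'k \<Rightarrow> bool" where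
  "bar_invariant t Z \<longleftrightarrow> (\<exists>P. emb t P = Z \<and> bar P = P)"

text \<open>\<open>[Z]\<^sup>t\<close>; the inverse of the leading coefficient is taken in \<open>F\<close>.\<close>

definition normalized :: "('i::finite, 'k::division_ring) qseed \<Rightarrow> 'k \<Rightarrow> 'k" where
  "normalized t Z =
     (let P = (THE P. emb t P = Z); g = (THE g. lp_has_degree t P g)
      in inverse (coef t (Poly_Mapping.lookup P g)) * Z)"

section \<open>Injective-reachability\<close>

text \<open>\<open>t1\<close> is a seed \<open>t[1]\<close>.\<close>

definition is_shift :: "('i::finite, 'k::division_ring) qseed \<Rightarrow> ('i, 'k) qseed \<Rightarrow> bool" where
  "is_shift t t1 \<longleftrightarrow> t1 \<in> Delta_plus t \<and>
     (\<exists>\<sigma>. \<sigma> permutes uf t \<and>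
        (\<forall>i\<in>uf t. \<forall>j\<in>uf t. bmat t1 $ \<sigma> i $ \<sigma> j = bmat t $ i $ j) \<and>
        (\<forall>k\<in>uf t. \<exists>g. has_degree t (tmon t1 (axis (\<sigma> k) 1)) g \<and>
           (\<forall>i\<in>uf t. g $ i = (- axis k 1 :: int ^ 'i) $ i)))"

definition injective_reachable :: "('i::finite, 'k::division_ring) qseed \<Rightarrow> bool" where
  "injective_reachable t \<longleftrightarrow> (\<exists>t1. is_shift t t1)"

section \<open>Triangular bases\<close>

definition zv_scale :: "('i::finite, 'k::division_ring) qseed \<Rightarrow> zv \<Rightarrow> 'k \<Rightarrow> 'k" where
  "zv_scale t p x = coef t p * x"

definition zv_subalgebra :: "('i::finite, 'k::division_ring) qseed \<Rightarrow> 'k set \<Rightarrow> bool" where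
  "zv_subalgebra t A \<longleftrightarrow>
     module.subspace (zv_scale t) A \<and> 1 \<in> A \<and> (\<forall>x\<in>A. \<forall>y\<in>A. x * y \<in> A)"

definition zv_basis :: "('i::finite, 'k::division_ring) qseed \<Rightarrow> 'k set \<Rightarrow> 'k set \<Rightarrow> bool" where
  "zv_basis t A L \<longleftrightarrow>
     \<not> module.dependent (zv_scale t) L \<and> module.span (zv_scale t) L = A"

text \<open>
  As all skew fields are identified, \<open>\<mu>\<^sup>*\<^bsub>t,t'\<^esub> A\<close> and \<open>\<mu>\<^sup>*\<^bsub>t,t'\<^esub> L\<close> are the same subsets \<open>A\<close> and \<open>L\<close>
  of \<open>F\<close>, and only their expansions depend on the seed.
\<close>

definition triangular_basis ::
  "('i::finite, 'k::division_ring) qseed \<Rightarrow> 'k set \<Rightarrow> 'k set \<Rightarrow> bool" where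
  "triangular_basis t A L \<longleftrightarrow>
     zv_basis t A L \<and>
     (\<forall>i. tmon t (axis i 1) \<in> L) \<and>
     (\<forall>Z\<in>L. bar_invariant t Z) \<and>
     (\<exists>Lg. L = range Lg \<and> (\<forall>g. pointed t g (Lg g)) \<and>
        (\<forall>g i. \<exists>b :: (int ^ 'i) \<Rightarrow>\<^sub>0 zv.
           normalized t (tmon t (axis i 1) * Lg g) =
             (\<Sum>g'\<in>Poly_Mapping.keys b. coef t (Poly_Mapping.lookup b g') * Lg g') \<and>
           (\<forall>g'\<in>Poly_Mapping.keys b. dom_le t g' (g + axis i 1)) \<and>
           Poly_Mapping.lookup b (g + axis i 1) = 1 \<and>
           (\<forall>g'. dom_less t g' (g + axis i 1) \<longrightarrow> Poly_Mapping.lookup b g' \<in> zv_le (- 1)))) \<and>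
     cluster_monomials_in t \<subseteq> L \<and>
     (\<exists>t1. is_shift t t1 \<and> cluster_monomials_in t1 \<subseteq> L)"

text \<open>
  The seeds \<open>t' \<in> \<Delta>\<^sup>+\<close> are ranged over together with a mutation sequence from \<open>t\<close> to \<open>t'\<close>, along
  which the tropical transformation \<open>\<phi>\<^bsub>t',t\<^esub>\<close> is computed; the result does not depend on it.
\<close>

definition common_triangular_basis ::
  "('i::finite, 'k::division_ring) qseed \<Rightarrow> 'k set \<Rightarrow> 'k set \<Rightarrow> bool" where
  "common_triangular_basis t A L \<longleftrightarrow>
     triangular_basis t A L \<and>
     (\<forall>ks. set ks \<subseteq> uf t \<longrightarrow>
        triangular_basis (mutate_seq ks t) A L \<and>
        (\<forall>g. \<forall>Z\<in>L. pointed t g Z \<longrightarrow> pointed (mutate_seq ks t) (trop_seq ks t g) Z))"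

end

theory Submission
  imports Defs
begin

text \<open>
  Let \<open>R = X(t')\<^sup>m\<close> be a cluster monomial and \<open>V \<in> L\<close>.  Iterating the triangularity axiom in \<open>t'\<close>
  gives \<open>R * V \<in> v\<^sup>s (S + \<Sum> \<^bold>m L)\<close>, where the compatibility of \<open>B\<close> and \<open>\<Lambda>\<close> keeps all powers of
  \<open>v\<close> of the lower terms at most \<open>s\<close>; inverse frozen variables only permute \<open>L\<close> up to powers of \<open>v\<close>,
  because a bar-invariant element of \<open>\<^bold>m\<close> vanishes.

  For the lower bound one passes to the seed \<open>t'' = t'[-1]\<close>, where the \<open>X\<^sub>k(t')\<close> have
  degrees \<open>-f\<^sub>i\<close> up to frozen directions.  Every degree in \<open>t''\<close> is then the
  degree of some \<open>X(t'')\<^sup>a * X(t')\<^sup>n\<close>, an element that is \<open>\<^bold>m\<close>-unitriangular in \<open>L\<close>.  Multiplying it on the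
  right by \<open>R\<close> gives an element of the same kind, so induction along the dominance order of \<open>t''\<close>
  yields \<open>V * R \<in> v\<^sup>-\<^sup>h (H + \<Sum> \<^bold>m L)\<close>.  The bar involution reverses this to \<open>R * V\<close>, and both
  expansions have the same coefficients.
\<close>

subsection \<open>Coefficients\<close>

text \<open>Compatibility gives \<open>lam_form (lam t) (bmat t *v n) m\<close> = \<Sum> n_k d_k
  m_k, so \<open>lam_form\<close> is monotone along the dominance order in each argument, in a
  direction set by the sign of the unfrozen entries of the other argument. Left multiplication by a
  degree nonnegative on \<open>uf t\<close>, or right multiplication by one nonpositive there, thus
  never gives lower terms a larger power of \<open>v\<close> than the leading one. A cluster
  monomial of \<open>t'\<close> is of the first kind in \<open>t'\<close> and of the second kind in
  \<open>t'[-1]\<close>; hence the change of seed. The difficulty is that no axiom describes right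
  multiplication. In \<open>t''\<close> only left multiplication by its own monomials is controlled,
  but \<open>X(t'')^a * X(t')^n * X(t')^m\<close> is, up to a power of \<open>v\<close>, again such
  a left multiple, namely of \<open>X(t')^(n+m)\<close> in \<open>L\<close>, and the unknown
  \<open>L_g * X(t')^m\<close> can be solved from it. That the basis is common enters twice: degrees
  of \<open>X(t')^n\<close> in \<open>t''\<close> become computable tropically, and the expansions
  of \<open>R * V\<close> made in different seeds run over one and the same set
  \<open>L\<close>.\<close>

lemma powi_qcommute:
  fixes x y c :: "'a::division_ring"
  assumes "\<And>z. c * z = z * c" "c \<noteq> 0" "x \<noteq> 0" "x * y = c * y * x"
  shows "x powi n * y = c powi n * y * x powi n"
proof -
  have c: "c ^ n * z = z * c ^ n" for n z
    by (simp add: assms(1) power_commuting_commutes)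
  have nat: "x ^ n * y = c ^ n * y * x ^ n" for n
  proof (induction n)
    case (Suc n)
    have "x ^ Suc n * y = x * (c ^ n * y * x ^ n)"
      using Suc by (simp add: mult.assoc)
    also have "\<dots> = c ^ n * (x * y) * x ^ n"
      by (metis c mult.assoc)
    also have "\<dots> = (c ^ n * c) * y * (x * x ^ n)"
      by (simp add: assms(4) mult.assoc)
    also have "\<dots> = c ^ Suc n * y * x ^ Suc n"
      by (simp only: power_Suc power_commutes)
    finally show ?case .
  qed simp
  show ?thesis
  proof (cases "n \<ge> 0")
    case True
    then show ?thesis by (simp add: power_int_nonneg_exp nat)
  next
    case False
    define k where "k = nat (- n)"
    have n: "n = - int k" using False by (simp add: k_def)
    \<comment> \<open>Negative exponents: the identity for \<open>x ^ k\<close>, multiplied by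
      \<open>inverse (x ^ k)\<close> on both sides.\<close>
    have "inverse (x ^ k) * (c ^ k * y * x ^ k) * inverse (x ^ k) = inverse (x^k) * (x^k * y) * inverse (x^k)"
      by (simp add: nat)
    also have "\<dots> = y * inverse (x ^ k)"
      using assms(3) by (simp flip: mult.assoc)
    finally have "inverse (x ^ k) * (c ^ k * y) = y * inverse (x ^ k)"
      using assms(3) by (simp add: mult.assoc)
    then have "c ^ k * (inverse (x ^ k) * y) = y * inverse (x ^ k)"
      by (metis c mult.assoc)
    then have "inverse (x ^ k) * y = inverse (c ^ k) * (y * inverse (x ^ k))"
      using assms(2) by (metis mult.assoc left_inverse power_not_zero mult_1)
    then show ?thesis
      by (simp add: n power_int_minus mult.assoc)
  qed
qed

lemma vpow_mult: "vpow a * vpow b = vpow (a + b)"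
  by (simp add: vpow_def mult_single)

lemma vpow_0 [simp]: "vpow 0 = 1"
  by (simp add: vpow_def)

text \<open>The commutative product with a constant polynomial serves throughout as scalar
  multiplication on Laurent polynomials.\<close>

lemma lookup_scale [simp]:
  "Poly_Mapping.lookup (Poly_Mapping.single 0 s * p) m = (s::'a::semiring_0) * Poly_Mapping.lookup p (m::'b::comm_monoid_add)"
  by (cases "Poly_Mapping.lookup p m = 0")
     (simp_all flip: mult_map_scale_conv_mult add: Poly_Mapping.map.rep_eq)

lemma poly_mapping_sum_single:
  "(\<Sum>m\<in>Poly_Mapping.keys P. Poly_Mapping.single m (Poly_Mapping.lookup P m)) = P"
  by (rule poly_mapping_eqI)
     (auto simp: lookup_sum lookup_single when_def in_keys_iff sum.delta)

lemma mult_eq_sum_single: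
  fixes p q :: zv
  shows "p * q = (\<Sum>a\<in>Poly_Mapping.keys p. \<Sum>b\<in>Poly_Mapping.keys q.
     Poly_Mapping.single (a + b) (Poly_Mapping.lookup p a * Poly_Mapping.lookup q b))"
proof -
  have "p * q = (\<Sum>a\<in>Poly_Mapping.keys p. Poly_Mapping.single a (Poly_Mapping.lookup p a)) *
       (\<Sum>b\<in>Poly_Mapping.keys q. Poly_Mapping.single b (Poly_Mapping.lookup q b))"
    by (simp only: poly_mapping_sum_single)
  then show ?thesis
    by (simp add: sum_product mult_single)
qed

lemma vpow_neq_0 [simp]: "vpow n \<noteq> 0"
  by (simp add: vpow_def)

lemma zv_le_iff: "p \<in> zv_le n \<longleftrightarrow> (\<forall>k>n. Poly_Mapping.lookup p k = 0)"
  unfolding zv_le_def by (auto simp: in_keys_iff subset_iff) (meson linorder_not_le)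

lemma zv_ge_iff: "p \<in> zv_ge n \<longleftrightarrow> (\<forall>k<n. Poly_Mapping.lookup p k = 0)"
  unfolding zv_ge_def by (auto simp: in_keys_iff subset_iff) (meson linorder_not_le)

lemma zv_le_0 [simp]: "0 \<in> zv_le n"
  by (simp add: zv_le_iff)

lemma zv_le_mono: "p \<in> zv_le a \<Longrightarrow> a \<le> b \<Longrightarrow> p \<in> zv_le b"
  by (auto simp: zv_le_iff)

lemma zv_le_vpow [simp]: "vpow a \<in> zv_le b \<longleftrightarrow> a \<le> b"
  by (auto simp: zv_le_def vpow_def)

lemma zv_ge_vpow [simp]: "vpow a \<in> zv_ge b \<longleftrightarrow> b \<le> a"
  by (auto simp: zv_ge_def vpow_def)

lemma zv_le_diff: "p \<in> zv_le n \<Longrightarrow> q \<in> zv_le n \<Longrightarrow> p - q \<in> zv_le n"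
  by (simp add: zv_le_iff lookup_minus)

lemma zv_le_sum: "(\<And>x. x \<in> S \<Longrightarrow> f x \<in> zv_le n) \<Longrightarrow> sum f S \<in> zv_le n"
  by (simp add: zv_le_iff lookup_sum)

lemma zv_le_mult: "p \<in> zv_le a \<Longrightarrow> q \<in> zv_le b \<Longrightarrow> p * q \<in> zv_le (a + b)"
  using keys_mult[of p q] unfolding zv_le_def by fastforce

lemma zv_ge_mult: "p \<in> zv_ge a \<Longrightarrow> q \<in> zv_ge b \<Longrightarrow> p * q \<in> zv_ge (a + b)"
  using keys_mult[of p q] unfolding zv_ge_def by fastforce

text \<open>Bounds from above and from below meet here; both places where an expansion collapses to
  one term, frozen variables and the case \<open>S = H\<close>, rest on it.\<close>

lemma zv_le_ge_eq_0: "p \<in> zv_le a \<Longrightarrow> p \<in> zv_ge b \<Longrightarrow> a < b \<Longrightarrow> p = 0"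
  by (rule poly_mapping_eqI) (metis lookup_zero zv_le_iff zv_ge_iff not_less order.strict_trans1)

section \<open>Bar involution on coefficients and on Laurent polynomials\<close>

definition zv_bar :: "zv \<Rightarrow> zv" where
  "zv_bar = Poly_Mapping.map_key uminus"

lemma lookup_zv_bar [simp]: "Poly_Mapping.lookup (zv_bar p) n = Poly_Mapping.lookup p (- n)"
  by (simp add: zv_bar_def map_key.rep_eq)

lemma zv_bar_0 [simp]: "zv_bar 0 = 0"
  by (rule poly_mapping_eqI) simp

lemma zv_bar_zv_bar [simp]: "zv_bar (zv_bar p) = p"
  by (rule poly_mapping_eqI) simp

lemma zv_bar_eq_0_iff [simp]: "zv_bar p = 0 \<longleftrightarrow> p = 0"
  by (metis zv_bar_0 zv_bar_zv_bar)

lemma zv_bar_sum: "zv_bar (sum f S) = (\<Sum>x\<in>S. zv_bar (f x))"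
  by (rule poly_mapping_eqI) (simp add: lookup_sum)

lemma zv_bar_single: "zv_bar (Poly_Mapping.single n a) = Poly_Mapping.single (- n) a"
  by (rule poly_mapping_eqI) (auto simp: lookup_single when_def)

lemma zv_bar_vpow [simp]: "zv_bar (vpow n) = vpow (- n)"
  by (simp add: vpow_def zv_bar_single)

lemma zv_bar_mult: "zv_bar (p * q) = zv_bar p * zv_bar q"
proof -
  have "zv_bar p * zv_bar q =
     zv_bar (\<Sum>a\<in>Poly_Mapping.keys p. Poly_Mapping.single a (Poly_Mapping.lookup p a)) *
     zv_bar (\<Sum>b\<in>Poly_Mapping.keys q. Poly_Mapping.single b (Poly_Mapping.lookup q b))"
    by (simp only: poly_mapping_sum_single)
  then show ?thesis
    by (simp add: zv_bar_sum zv_bar_single sum_product mult_single mult_eq_sum_single[of p q]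
        add.commute)
qed

lemma zv_bar_le: "p \<in> zv_le n \<Longrightarrow> zv_bar p \<in> zv_ge (- n)"
  by (auto simp: zv_le_iff zv_ge_iff)

lemma lookup_bar: "Poly_Mapping.lookup (bar P) m = zv_bar (Poly_Mapping.lookup P m)"
  by (auto simp: bar_def Poly_Mapping.map.rep_eq zv_bar_def when_def)

lemma keys_bar: "Poly_Mapping.keys (bar P) = Poly_Mapping.keys P"
  by (auto simp: in_keys_iff lookup_bar)

lemma bar_sum: "bar (sum f S) = (\<Sum>x\<in>S. bar (f x))"
  by (rule poly_mapping_eqI) (simp add: lookup_sum lookup_bar zv_bar_sum)

lemma bar_single: "bar (Poly_Mapping.single m p) = Poly_Mapping.single m (zv_bar p)"
  by (rule poly_mapping_eqI) (auto simp: lookup_bar lookup_single when_def)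

lemma bar_scale: "bar (Poly_Mapping.single 0 p * P) = Poly_Mapping.single 0 (zv_bar p) * bar P"
  by (rule poly_mapping_eqI) (simp add: lookup_bar zv_bar_mult)

subsection \<open>Linear combinations\<close>

text \<open>Covers two kinds of expansion with one proof of linearity: over Laurent monomials, which
  is \<open>emb t\<close>, and over the basis elements \<open>Lg\<close>.\<close>

definition lincomb :: "(zv \<Rightarrow> 'k::ring) \<Rightarrow> (int ^ 'i \<Rightarrow> 'k) \<Rightarrow> 'i::finite lp \<Rightarrow> 'k" where
  "lincomb c X P = (\<Sum>m\<in>Poly_Mapping.keys P. c (Poly_Mapping.lookup P m) * X m)"

lemma emb_lincomb: "emb t = lincomb (coef t) (tmon t)"
  by (simp add: fun_eq_iff emb_def lincomb_def)

lemma coef_superset: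
  "finite S \<Longrightarrow> Poly_Mapping.keys p \<subseteq> S \<Longrightarrow>
    coef t p = (\<Sum>n\<in>S. of_int (Poly_Mapping.lookup p n) * vq t powi n)"
  unfolding coef_def by (rule sum.mono_neutral_left) (auto simp: in_keys_iff)

lemma coef_0 [simp]: "coef t 0 = 0"
  by (simp add: coef_def)

lemma coef_add: "coef t (p + q) = coef t p + coef t q"
proof -
  let ?S = "Poly_Mapping.keys p \<union> Poly_Mapping.keys q"
  have "coef t (p + q) = (\<Sum>n\<in>?S. of_int (Poly_Mapping.lookup (p + q) n) * vq t powi n)"
    by (rule coef_superset) (use keys_add[of p q] in auto)
  then show ?thesis
    by (simp add: coef_superset[of ?S p] coef_superset[of ?S q] lookup_add distrib_right sum.distrib)
qed

lemma coef_minus: "coef t (- p) = - coef t p"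
  using coef_add[of t p "- p"] by (simp add: eq_neg_iff_add_eq_0 add.commute)

lemma coef_diff: "coef t (p - q) = coef t p - coef t q"
  using coef_add[of t p "- q"] by (simp add: coef_minus)

lemma coef_sum: "coef t (sum f S) = (\<Sum>x\<in>S. coef t (f x))"
  by (induction S rule: infinite_finite_induct) (simp_all add: coef_add)

lemma coef_single [simp]: "coef t (Poly_Mapping.single n a) = of_int a * vq t powi n"
  by (cases "a = 0") (simp_all add: coef_def)

lemma coef_1 [simp]: "coef t 1 = 1"
  using coef_single[of t 0 1] by simp

lemma coef_vpow [simp]: "coef t (vpow n) = vq t powi n"
  by (simp add: vpow_def)

context
  fixes c :: "zv \<Rightarrow> 'k::ring" and X :: "int ^ 'i::finite \<Rightarrow> 'k"
  assumes c_add: "\<And>p q. c (p + q) = c p + c q"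
begin

lemma lincomb_c_0: "c 0 = 0"
  using c_add[of 0 0] by simp

lemma lincomb_superset:
  "finite S \<Longrightarrow> Poly_Mapping.keys P \<subseteq> S \<Longrightarrow>
    lincomb c X P = (\<Sum>n\<in>S. c (Poly_Mapping.lookup P n) * X n)"
  unfolding lincomb_def
  by (rule sum.mono_neutral_left) (auto simp: in_keys_iff lincomb_c_0)

lemma lincomb_add: "lincomb c X (P + Q) = lincomb c X P + lincomb c X Q"
proof -
  let ?S = "Poly_Mapping.keys P \<union> Poly_Mapping.keys Q"
  have "lincomb c X (P + Q) = (\<Sum>n\<in>?S. c (Poly_Mapping.lookup (P + Q) n) * X n)"
    by (rule lincomb_superset) (use keys_add[of P Q] in auto)
  then show ?thesis
    by (simp add: lincomb_superset[of ?S P] lincomb_superset[of ?S Q] lookup_add c_add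
        distrib_right sum.distrib)
qed

lemma lincomb_0: "lincomb c X 0 = 0"
  by (simp add: lincomb_def)

lemma lincomb_minus: "lincomb c X (- P) = - lincomb c X P"
  using lincomb_add[of P "- P"] by (simp add: eq_neg_iff_add_eq_0 add.commute lincomb_0)

lemma lincomb_diff: "lincomb c X (P - Q) = lincomb c X P - lincomb c X Q"
  using lincomb_add[of P "- Q"] by (simp add: lincomb_minus)

lemma lincomb_sum: "lincomb c X (sum f S) = (\<Sum>x\<in>S. lincomb c X (f x))"
  by (induction S rule: infinite_finite_induct) (simp_all add: lincomb_add lincomb_0)

lemma lincomb_single: "lincomb c X (Poly_Mapping.single m p) = c p * X m"
  by (cases "p = 0") (simp_all add: lincomb_def lincomb_c_0)

lemma lincomb_scale:
  assumes "\<And>p q. c (p * q) = c p * c q"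
  shows "lincomb c X (Poly_Mapping.single 0 p * P) = c p * lincomb c X P"
proof -
  have "Poly_Mapping.keys (Poly_Mapping.single 0 p * P) \<subseteq> Poly_Mapping.keys P"
    by (auto simp: in_keys_iff)
  then show ?thesis
    by (subst lincomb_superset[of "Poly_Mapping.keys P"])
       (auto simp: assms lincomb_def sum_distrib_left mult.assoc)
qed

end

subsection \<open>Bilinear form\<close>

lemma lam_form_add_left: "lam_form \<Lambda> (a + b) m = lam_form \<Lambda> a m + lam_form \<Lambda> b m"
  by (simp add: lam_form_def algebra_simps sum.distrib)

lemma lam_form_add_right: "lam_form \<Lambda> m (a + b) = lam_form \<Lambda> m a + lam_form \<Lambda> m b"
  by (simp add: lam_form_def algebra_simps sum.distrib)

lemma lam_form_minus_left: "lam_form \<Lambda> (- a) m = - lam_form \<Lambda> a m"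
  by (simp add: lam_form_def sum_negf)

lemma lam_form_minus_right: "lam_form \<Lambda> m (- a) = - lam_form \<Lambda> m a"
  by (simp add: lam_form_def sum_negf)

lemma lam_form_diff_left: "lam_form \<Lambda> (a - b) m = lam_form \<Lambda> a m - lam_form \<Lambda> b m"
  using lam_form_add_left[of \<Lambda> a "- b" m] by (simp add: lam_form_minus_left)

lemma lam_form_diff_right: "lam_form \<Lambda> m (a - b) = lam_form \<Lambda> m a - lam_form \<Lambda> m b"
  using lam_form_add_right[of \<Lambda> m a "- b"] by (simp add: lam_form_minus_right)

lemma lam_form_0_left [simp]: "lam_form \<Lambda> 0 m = 0"
  by (simp add: lam_form_def)

lemma lam_form_0_right [simp]: "lam_form \<Lambda> m 0 = 0"
  by (simp add: lam_form_def)

lemma lam_form_scale_left: "lam_form \<Lambda> (c *s a) m = c * lam_form \<Lambda> a m"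
  by (simp add: lam_form_def sum_distrib_left mult.assoc)

lemma lam_form_scale_right: "lam_form \<Lambda> m (c *s a) = c * lam_form \<Lambda> m a"
  by (simp add: lam_form_def sum_distrib_left algebra_simps)

lemma lam_form_sum_left: "lam_form \<Lambda> (sum f S) m = (\<Sum>x\<in>S. lam_form \<Lambda> (f x) m)"
  by (induction S rule: infinite_finite_induct) (simp_all add: lam_form_add_left)

lemma lam_form_sum_right: "lam_form \<Lambda> m (sum f S) = (\<Sum>x\<in>S. lam_form \<Lambda> m (f x))"
  by (induction S rule: infinite_finite_induct) (simp_all add: lam_form_add_right)

lemma lam_form_axis: "lam_form \<Lambda> (axis i 1) (axis j 1) = \<Lambda> $ i $ j"
proof -
  have "lam_form \<Lambda> (axis i 1) (axis j 1) =
    (\<Sum>a\<in>UNIV. \<Sum>b\<in>UNIV. if a = i \<and> b = j then \<Lambda> $ i $ j else 0)"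
    unfolding lam_form_def by (intro sum.cong refl) (auto simp: axis_def)
  also have "\<dots> = (\<Sum>a\<in>UNIV. if a = i then \<Lambda> $ i $ j else 0)"
    by (intro sum.cong refl) auto
  finally show ?thesis by simp
qed

lemma vec_sum_axis: "(m :: int ^ 'i::finite) = (\<Sum>i\<in>UNIV. m $ i *s axis i 1)"
  by (simp add: vec_eq_iff axis_def if_distrib[of "(*) _"] cong: if_cong)

lemma lam_form_expand_right:
  "lam_form \<Lambda> a m = (\<Sum>j\<in>UNIV. m $ j * lam_form \<Lambda> a (axis j 1))"
  by (subst vec_sum_axis[of m]) (simp add: lam_form_sum_right lam_form_scale_right)

lemma lam_form_expand_left:
  "lam_form \<Lambda> m a = (\<Sum>j\<in>UNIV. m $ j * lam_form \<Lambda> (axis j 1) a)"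
  by (subst vec_sum_axis[of m]) (simp add: lam_form_sum_left lam_form_scale_left)

lemma lam_form_skew_symmetric:
  assumes "\<And>i j. \<Lambda> $ j $ i = - (\<Lambda> $ i $ j)"
  shows "lam_form \<Lambda> a b = - lam_form \<Lambda> b a"
proof -
  have "lam_form \<Lambda> a b = (\<Sum>j\<in>UNIV. \<Sum>i\<in>UNIV. a $ i * \<Lambda> $ i $ j * b $ j)"
    unfolding lam_form_def by (rule sum.swap)
  also have "\<dots> = (\<Sum>j\<in>UNIV. \<Sum>i\<in>UNIV. - (b $ j * \<Lambda> $ j $ i * a $ i))"
  proof (intro sum.cong refl)
    fix i j
    show "a $ i * \<Lambda> $ i $ j * b $ j = - (b $ j * \<Lambda> $ j $ i * a $ i)"
      by (subst assms[where i = i and j = j]) (simp add: mult_ac)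
  qed
  also have "\<dots> = - lam_form \<Lambda> b a"
    by (simp add: lam_form_def sum_negf)
  finally show ?thesis .
qed

text \<open>Bar turns the twist \<open>v^\<lambda>(m,m')\<close> into its inverse, which by
  skew-symmetry is the twist of the reversed product. Bar is therefore an anti-automorphism.\<close>

lemma bar_twisted_mult:
  assumes "\<And>i j. \<Lambda> $ j $ i = - (\<Lambda> $ i $ j)"
  shows "bar (twisted_mult \<Lambda> P Q) = twisted_mult \<Lambda> (bar Q) (bar P)"
proof -
  have "bar (twisted_mult \<Lambda> P Q) =
     (\<Sum>m\<in>Poly_Mapping.keys P. \<Sum>m'\<in>Poly_Mapping.keys Q.
        Poly_Mapping.single (m' + m)
          (vpow (lam_form \<Lambda> m' m) * Poly_Mapping.lookup (bar Q) m' * Poly_Mapping.lookup (bar P) m))"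
    unfolding twisted_mult_def bar_sum bar_single zv_bar_mult zv_bar_vpow lookup_bar
  proof (intro sum.cong refl)
    fix m m'
    have "- lam_form \<Lambda> m m' = lam_form \<Lambda> m' m"
      using lam_form_skew_symmetric[OF assms, of m m'] by simp
    then show "Poly_Mapping.single (m + m') (vpow (- lam_form \<Lambda> m m') *
        zv_bar (Poly_Mapping.lookup P m) * zv_bar (Poly_Mapping.lookup Q m')) =
      Poly_Mapping.single (m' + m) (vpow (lam_form \<Lambda> m' m) *
        zv_bar (Poly_Mapping.lookup Q m') * zv_bar (Poly_Mapping.lookup P m))"
      by (simp add: add.commute mult_ac)
  qed
  then show ?thesis
    unfolding twisted_mult_def keys_bar by (subst sum.swap)
qed

lemma matrix_vector_axis: "((B :: int ^ 'n::finite ^ 'm::finite) *v axis k 1) $ i = B $ i $ k"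
  by (simp add: matrix_vector_mult_def axis_def if_distrib[of "(*) _"] cong: if_cong)

subsection \<open>Quantum tori and the dominance order\<close>

text \<open>The part of a quantum seed that is carried along mutations. The fraction property is
  replaced by its consequence that \<open>v\<close> is central, which does not refer to the seed;
  compatibility is phrased through the columns of \<open>bmat t\<close>, with one family
  \<open>d\<close> for all seeds.\<close>

locale quantum_torus =
  fixes t :: "('i::finite, 'k::division_ring) qseed" and d :: "'i \<Rightarrow> int"
  assumes vq_central: "vq t * x = x * vq t"
    and vq_neq_0: "vq t \<noteq> 0"
    and tmon_0: "tmon t 0 = 1"
    and tmon_mult: "tmon t m * tmon t m' = vq t powi lam_form (lam t) m m' * tmon t (m + m')"
    and inj_emb: "inj (emb t)"
    and bmat_frozen: "j \<notin> uf t \<Longrightarrow> bmat t $ i $ j = 0"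
    and lam_skew: "lam t $ j $ i = - (lam t $ i $ j)"
    and d_pos: "k \<in> uf t \<Longrightarrow> 0 < d k"
    and compat: "k \<in> uf t \<Longrightarrow> lam_form (lam t) (bmat t *v axis k 1) m = d k * m $ k"
begin

lemma powi_central: "vq t powi n * x = x * vq t powi n"
proof (cases "n \<ge> 0")
  case True
  then show ?thesis
    by (simp add: power_int_nonneg_exp vq_central power_commuting_commutes)
next
  case False
  have "inverse (vq t) * x = x * inverse (vq t)"
    by (metis mult_commute_imp_mult_inverse_commute vq_central)
  with False show ?thesis
    by (simp add: power_int_def power_commuting_commutes)
qed

lemma coef_central: "coef t p * x = x * coef t p"
proof -
  have "of_int a * vq t powi n * x = x * (of_int a * vq t powi n)" for a n
    by (metis powi_central mult_of_int_commute mult.assoc)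
  then show ?thesis
    by (simp add: coef_def sum_distrib_left sum_distrib_right)
qed

lemma powi_add: "vq t powi (m + n) = vq t powi m * vq t powi n"
  by (simp add: power_int_add vq_neq_0)

lemma coef_mult: "coef t (p * q) = coef t p * coef t q"
proof -
  have "coef t (p * q) = (\<Sum>a\<in>Poly_Mapping.keys p. \<Sum>b\<in>Poly_Mapping.keys q.
     of_int (Poly_Mapping.lookup p a * Poly_Mapping.lookup q b) * vq t powi (a + b))"
    by (subst mult_eq_sum_single) (simp add: coef_sum)
  also have "\<dots> = coef t p * coef t q"
    unfolding coef_def sum_product
  proof (intro sum.cong refl)
    fix a b
    have "vq t powi a * (of_int n * z) = of_int n * (vq t powi a * z)" for n z
      by (metis mult_of_int_commute mult.assoc)
    then show "of_int (Poly_Mapping.lookup p a * Poly_Mapping.lookup q b) * vq t powi (a + b) =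
       of_int (Poly_Mapping.lookup p a) * vq t powi a * (of_int (Poly_Mapping.lookup q b) * vq t powi b)"
      by (simp only: powi_add of_int_mult mult.assoc)
  qed
  finally show ?thesis .
qed

lemmas lincomb_rules =
  lincomb_add[of "coef t", OF coef_add] lincomb_diff[of "coef t", OF coef_add]
  lincomb_sum[of "coef t", OF coef_add] lincomb_single[of "coef t", OF coef_add]
  lincomb_0[of "coef t", OF coef_add]
  lincomb_scale[of "coef t", OF coef_add coef_mult]

lemmas emb_rules = lincomb_rules[where X = "tmon t", folded emb_lincomb]

lemma emb_scale: "emb t (Poly_Mapping.single 0 p * P) = coef t p * emb t P"
  by (rule emb_rules)

lemma emb_twisted_mult: "emb t (twisted_mult (lam t) P Q) = emb t P * emb t Q"
proof -
  have "emb t (twisted_mult (lam t) P Q) = (\<Sum>m\<in>Poly_Mapping.keys P. \<Sum>m'\<in>Poly_Mapping.keys Q.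
        vq t powi lam_form (lam t) m m' * coef t (Poly_Mapping.lookup P m) *
        coef t (Poly_Mapping.lookup Q m') * tmon t (m + m'))"
    by (simp add: twisted_mult_def emb_rules coef_mult)
  also have "\<dots> = emb t P * emb t Q"
    unfolding emb_def sum_product
  proof (intro sum.cong refl)
    fix m m'
    show "vq t powi lam_form (lam t) m m' * coef t (Poly_Mapping.lookup P m) *
        coef t (Poly_Mapping.lookup Q m') * tmon t (m + m') =
      coef t (Poly_Mapping.lookup P m) * tmon t m * (coef t (Poly_Mapping.lookup Q m') * tmon t m')"
      by (metis (no_types) coef_central tmon_mult powi_central mult.assoc)
  qed
  finally show ?thesis .
qed

lemma emb_eq_iff: "emb t P = emb t Q \<longleftrightarrow> P = Q"
  using inj_emb by (simp add: inj_eq)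

lemma emb_eq_0_iff: "emb t P = 0 \<longleftrightarrow> P = 0"
  using emb_eq_iff[of P 0] by (simp add: emb_rules)

lemma lam_form_skew: "lam_form (lam t) a b = - lam_form (lam t) b a"
  by (rule lam_form_skew_symmetric) (rule lam_skew)

lemma lam_form_self [simp]: "lam_form (lam t) a a = 0"
  using lam_form_skew[of a a] by simp

lemma lam_form_bmat:
  assumes "\<And>i. i \<notin> uf t \<Longrightarrow> n $ i = 0"
  shows "lam_form (lam t) (bmat t *v n) m = (\<Sum>k\<in>uf t. n $ k * (d k * m $ k))"
proof -
  have B: "bmat t *v n = (\<Sum>k\<in>UNIV. n $ k *s (bmat t *v axis k 1))"
    by (simp add: vec_eq_iff matrix_vector_axis) (simp add: matrix_vector_mult_def mult.commute)
  have "lam_form (lam t) (bmat t *v n) m = (\<Sum>k\<in>UNIV. n $ k * lam_form (lam t) (bmat t *v axis k 1) m)"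
    unfolding B by (simp add: lam_form_sum_left lam_form_scale_left)
  also have "\<dots> = (\<Sum>k\<in>uf t. n $ k * lam_form (lam t) (bmat t *v axis k 1) m)"
    by (rule sum.mono_neutral_right) (auto simp: assms)
  finally show ?thesis
    by (simp add: compat)
qed

section \<open>Dominance order and monotonicity of the form\<close>

lemma dom_le_refl [simp]: "dom_le t g g"
  unfolding dom_le_def by (rule exI[of _ 0]) simp

lemma dom_le_trans: "dom_le t a b \<Longrightarrow> dom_le t b c \<Longrightarrow> dom_le t a c"
  unfolding dom_le_def
proof (elim exE conjE)
  fix n n'
  assume "\<forall>i. 0 \<le> n $ i" "\<forall>i. i \<notin> uf t \<longrightarrow> n $ i = 0" "a = b + bmat t *v n"
    "\<forall>i. 0 \<le> n' $ i" "\<forall>i. i \<notin> uf t \<longrightarrow> n' $ i = 0" "b = c + bmat t *v n'"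
  then show "\<exists>n. (\<forall>i. 0 \<le> n $ i) \<and> (\<forall>i. i \<notin> uf t \<longrightarrow> n $ i = 0) \<and> a = c + bmat t *v n"
    by (intro exI[of _ "n + n'"]) (simp add: matrix_vector_right_distrib)
qed

lemma dom_le_add [simp]: "dom_le t (a + c) (b + c) \<longleftrightarrow> dom_le t a b"
  by (simp add: dom_le_def algebra_simps)

lemma dom_le_add_left [simp]: "dom_le t (c + a) (c + b) \<longleftrightarrow> dom_le t a b"
  by (simp add: dom_le_def algebra_simps)

lemma dom_less_add [simp]: "dom_less t (a + c) (b + c) \<longleftrightarrow> dom_less t a b"
  by (simp add: dom_less_def)

lemma dom_le_lam_form_le:
  assumes "dom_le t a b" "\<And>k. k \<in> uf t \<Longrightarrow> m $ k \<le> 0"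
  shows "lam_form (lam t) a m \<le> lam_form (lam t) b m"
proof -
  obtain n where n: "\<And>i. 0 \<le> n $ i" "\<And>i. i \<notin> uf t \<Longrightarrow> n $ i = 0" "a = b + bmat t *v n"
    using assms(1) by (auto simp: dom_le_def)
  have "(\<Sum>k\<in>uf t. n $ k * (d k * m $ k)) \<le> 0"
    by (intro sum_nonpos mult_nonneg_nonpos n) (use assms(2) d_pos in \<open>auto intro!: mult_nonneg_nonpos less_imp_le\<close>)
  then show ?thesis
    by (simp add: n(3) lam_form_add_left lam_form_bmat n(2))
qed

lemma dom_le_lam_form_ge:
  assumes "dom_le t a b" "\<And>k. k \<in> uf t \<Longrightarrow> m $ k \<ge> 0"
  shows "lam_form (lam t) m a \<le> lam_form (lam t) m b"
  using dom_le_lam_form_le[of a b "- m"] assms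
  by (simp add: lam_form_minus_right lam_form_skew[of m])

lemma dom_le_lam_form_eq:
  assumes "dom_le t a b" "\<And>k. k \<in> uf t \<Longrightarrow> m $ k = 0"
  shows "lam_form (lam t) m a = lam_form (lam t) m b"
  using dom_le_lam_form_ge[of a b m] dom_le_lam_form_ge[of a b "- m"] assms
  by (simp add: lam_form_minus_left)

text \<open>A linear function that grows strictly when going down the dominance order: adding
  \<open>bmat t *v n\<close> raises it by \<Sum> n_k d_k. It yields antisymmetry, maximal elements
  and, later, the measure of an induction.\<close>

definition height :: "int ^ 'i \<Rightarrow> int" where
  "height g = lam_form (lam t) g (\<chi> i. if i \<in> uf t then 1 else 0)"

lemma height_add: "height (a + b) = height a + height b"
  by (simp add: height_def lam_form_add_left)

lemma dom_less_height:
  assumes "dom_less t a b"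
  shows "height b < height a"
proof -
  obtain n where n: "\<And>i. 0 \<le> n $ i" "\<And>i. i \<notin> uf t \<Longrightarrow> n $ i = 0" "a = b + bmat t *v n" "a \<noteq> b"
    using assms unfolding dom_le_def dom_less_def by blast
  have "n \<noteq> 0" using n by auto
  then obtain j where j: "n $ j \<noteq> 0" by (auto simp: vec_eq_iff)
  then have juf: "j \<in> uf t" using n(2) by blast
  have "0 < (\<Sum>k\<in>uf t. n $ k * d k)"
  proof (rule sum_pos2)
    show "0 < n $ j * d j"
      using j n(1)[of j] d_pos[OF juf] by simp
    show "0 \<le> n $ k * d k" if "k \<in> uf t" for k
      using n(1)[of k] d_pos[OF that] by simp
  qed (use juf in auto)
  then show ?thesis
    by (simp add: n(3) height_add height_def[of "bmat t *v n"] lam_form_bmat n(2))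
qed

lemma dom_le_antisym: "dom_le t a b \<Longrightarrow> dom_le t b a \<Longrightarrow> a = b"
  using dom_less_height[of a b] dom_less_height[of b a] unfolding dom_less_def
  by (metis order.asym)

lemma dom_less_imp_le: "dom_less t a b \<Longrightarrow> dom_le t a b"
  by (simp add: dom_less_def)

lemma ex_maximal_above:
  assumes "finite S" "h \<in> S"
  obtains m where "m \<in> S" "dom_le t h m" "\<And>m'. m' \<in> S \<Longrightarrow> \<not> dom_less t m m'"
proof -
  let ?U = "{m \<in> S. dom_le t h m}"
  have fin: "finite (height ` ?U)" and ne: "height ` ?U \<noteq> {}"
    using assms by auto
  \<comment> \<open>Height grows downwards, so least height marks a maximal element.\<close>
  obtain m where m: "m \<in> ?U" "height m = Min (height ` ?U)"
    using Min_in[OF fin ne] by auto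
  have "\<not> dom_less t m m'" if "m' \<in> S" for m'
  proof
    assume l: "dom_less t m m'"
    then have "m' \<in> ?U"
      using m that dom_le_trans dom_less_imp_le by blast
    then have "height m \<le> height m'"
      using fin m(2) by simp
    then show False using dom_less_height[OF l] by simp
  qed
  then show thesis using m that by blast
qed

section \<open>Degrees and products of pointed elements\<close>

lemma lp_has_degree_iff:
  "lp_has_degree t P g \<longleftrightarrow> g \<in> Poly_Mapping.keys P \<and> (\<forall>m\<in>Poly_Mapping.keys P. dom_le t m g)"
proof
  assume deg: "lp_has_degree t P g"
  then have g: "g \<in> Poly_Mapping.keys P" unfolding lp_has_degree_def by blast
  \<comment> \<open>The support is finite, so each exponent lies below some maximal one, and
    \<open>g\<close> is the only maximal one.\<close>
  have "dom_le t m g" if m: "m \<in> Poly_Mapping.keys P" for m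
  proof -
    obtain m' where m': "m' \<in> Poly_Mapping.keys P" "dom_le t m m'"
      "\<And>m''. m'' \<in> Poly_Mapping.keys P \<Longrightarrow> \<not> dom_less t m' m''"
      using ex_maximal_above[OF finite_keys m] by blast
    then have "m' = g" using deg unfolding lp_has_degree_def by blast
    then show ?thesis using m' by simp
  qed
  with g show "g \<in> Poly_Mapping.keys P \<and> (\<forall>m\<in>Poly_Mapping.keys P. dom_le t m g)" by blast
next
  assume "g \<in> Poly_Mapping.keys P \<and> (\<forall>m\<in>Poly_Mapping.keys P. dom_le t m g)"
  then show "lp_has_degree t P g"
    unfolding lp_has_degree_def dom_less_def by (auto intro: dom_le_antisym)
qed

lemma lp_has_degree_unique: "lp_has_degree t P g \<Longrightarrow> lp_has_degree t P g' \<Longrightarrow> g = g'"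
  by (simp add: lp_has_degree_def)

lemma pointed_iff:
  "pointed t g Z \<longleftrightarrow> (\<exists>P. emb t P = Z \<and> Poly_Mapping.lookup P g = 1 \<and>
     (\<forall>m\<in>Poly_Mapping.keys P. dom_le t m g))"
  unfolding pointed_def lp_has_degree_iff by (metis in_keys_iff zero_neq_one)

lemma pointed_unique: "pointed t g Z \<Longrightarrow> pointed t g' Z \<Longrightarrow> g = g'"
  unfolding pointed_def using emb_eq_iff lp_has_degree_unique by metis

lemma pointed_has_degree: "pointed t g Z \<Longrightarrow> has_degree t Z g"
  unfolding pointed_def has_degree_def by blast

lemma has_degree_unique: "has_degree t Z g \<Longrightarrow> has_degree t Z g' \<Longrightarrow> g = g'"
  unfolding has_degree_def using emb_eq_iff lp_has_degree_unique by metis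

lemma pointed_tmon: "pointed t m (tmon t m)"
  unfolding pointed_iff
  by (rule exI[of _ "Poly_Mapping.single m 1"]) (simp add: emb_rules)

lemma lookup_twisted_mult:
  "Poly_Mapping.lookup (twisted_mult \<Lambda> P Q) h =
    (\<Sum>m\<in>Poly_Mapping.keys P. \<Sum>m'\<in>Poly_Mapping.keys Q. if m + m' = h
       then vpow (lam_form \<Lambda> m m') * Poly_Mapping.lookup P m * Poly_Mapping.lookup Q m' else 0)"
  by (simp add: twisted_mult_def lookup_sum lookup_single when_def)

text \<open>Nothing cancels at the top: \<open>m + m' = g + g'\<close> with both summands dominated
  gives \<open>g + m' \<preceq> g + g' = m + m'\<close>-type comparisons, and antisymmetry forces
  \<open>m = g\<close> and \<open>m' = g'\<close>.\<close>

lemma twisted_mult_leading: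
  assumes P: "\<And>m. m \<in> Poly_Mapping.keys P \<Longrightarrow> dom_le t m g" "g \<in> Poly_Mapping.keys P"
    and Q: "\<And>m. m \<in> Poly_Mapping.keys Q \<Longrightarrow> dom_le t m g'" "g' \<in> Poly_Mapping.keys Q"
  shows "Poly_Mapping.lookup (twisted_mult (lam t) P Q) (g + g') =
     vpow (lam_form (lam t) g g') * Poly_Mapping.lookup P g * Poly_Mapping.lookup Q g'"
proof -
  let ?f = "\<lambda>m m'. vpow (lam_form (lam t) m m') * Poly_Mapping.lookup P m * Poly_Mapping.lookup Q m'"
  have eq: "m + m' = g + g' \<longleftrightarrow> m = g \<and> m' = g'"
    if "m \<in> Poly_Mapping.keys P" "m' \<in> Poly_Mapping.keys Q" for m m'
  proof
    assume e: "m + m' = g + g'"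
    have "dom_le t (m + m') (m + g')" using Q(1)[OF that(2)] by simp
    then have "dom_le t g m" by (simp add: e)
    then have "m = g" using P(1)[OF that(1)] dom_le_antisym by blast
    with e show "m = g \<and> m' = g'" by simp
  qed simp
  have "Poly_Mapping.lookup (twisted_mult (lam t) P Q) (g + g') =
    (\<Sum>m\<in>Poly_Mapping.keys P. \<Sum>m'\<in>Poly_Mapping.keys Q. if m = g \<and> m' = g' then ?f g g' else 0)"
    unfolding lookup_twisted_mult by (intro sum.cong refl) (auto simp: eq)
  also have "\<dots> = (\<Sum>m\<in>Poly_Mapping.keys P. if m = g then ?f g g' else 0)"
    using Q(2) by (intro sum.cong refl) auto
  also have "\<dots> = ?f g g'" using P(2) by simp
  finally show ?thesis .
qed

lemma keys_twisted_mult: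
  "Poly_Mapping.keys (twisted_mult \<Lambda> P Q) \<subseteq>
    {m + m' |m m'. m \<in> Poly_Mapping.keys P \<and> m' \<in> Poly_Mapping.keys Q}"
proof
  fix h assume "h \<in> Poly_Mapping.keys (twisted_mult \<Lambda> P Q)"
  then have "Poly_Mapping.lookup (twisted_mult \<Lambda> P Q) h \<noteq> 0" by (simp add: in_keys_iff)
  then obtain m where m: "m \<in> Poly_Mapping.keys P" "(\<Sum>m'\<in>Poly_Mapping.keys Q. if m + m' = h
       then vpow (lam_form \<Lambda> m m') * Poly_Mapping.lookup P m * Poly_Mapping.lookup Q m' else 0) \<noteq> 0"
    unfolding lookup_twisted_mult by (meson sum.neutral)
  have "\<exists>m'\<in>Poly_Mapping.keys Q. m + m' = h"
  proof (rule ccontr)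
    assume "\<not> (\<exists>m'\<in>Poly_Mapping.keys Q. m + m' = h)"
    then have "(\<Sum>m'\<in>Poly_Mapping.keys Q. if m + m' = h
       then vpow (lam_form \<Lambda> m m') * Poly_Mapping.lookup P m * Poly_Mapping.lookup Q m' else 0) = 0"
      by (intro sum.neutral) auto
    with m(2) show False by contradiction
  qed
  then obtain m' where "m' \<in> Poly_Mapping.keys Q" "m + m' = h"
    by blast
  then show "h \<in> {m + m' |m m'. m \<in> Poly_Mapping.keys P \<and> m' \<in> Poly_Mapping.keys Q}"
    using m by blast
qed

lemma pointed_mult:
  assumes "pointed t g x" "pointed t g' y"
  shows "pointed t (g + g') (vq t powi (- lam_form (lam t) g g') * (x * y))"
proof -
  obtain P Q where P: "emb t P = x" "Poly_Mapping.lookup P g = 1" "\<And>m. m \<in> Poly_Mapping.keys P \<Longrightarrow> dom_le t m g"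
    and Q: "emb t Q = y" "Poly_Mapping.lookup Q g' = 1" "\<And>m. m \<in> Poly_Mapping.keys Q \<Longrightarrow> dom_le t m g'"
    using assms unfolding pointed_iff by blast
  let ?R = "Poly_Mapping.single 0 (vpow (- lam_form (lam t) g g')) * twisted_mult (lam t) P Q"
  have g: "g \<in> Poly_Mapping.keys P" "g' \<in> Poly_Mapping.keys Q"
    using P Q by (simp_all add: in_keys_iff)
  have "Poly_Mapping.lookup ?R (g + g') = 1"
    using twisted_mult_leading[OF P(3) g(1) Q(3) g(2)] by (simp add: P Q vpow_mult)
  moreover have "dom_le t m (g + g')" if "m \<in> Poly_Mapping.keys ?R" for m
  proof -
    have "m \<in> Poly_Mapping.keys (twisted_mult (lam t) P Q)"
      using that by (auto simp: in_keys_iff)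
    then obtain a b where "m = a + b" "a \<in> Poly_Mapping.keys P" "b \<in> Poly_Mapping.keys Q"
      using keys_twisted_mult by blast
    then show ?thesis
      using P(3)[of a] Q(3)[of b] dom_le_add dom_le_add_left dom_le_trans by metis
  qed
  ultimately show ?thesis
    unfolding pointed_iff
    by (intro exI[of _ ?R]) (simp add: emb_scale emb_twisted_mult P Q)
qed

end

text \<open>\<open>v\<close> is the image of a monomial of exponent 0, so it commutes with the image
  of every Laurent polynomial, hence with inverses of such images and with all fractions. This is
  the one use of the fraction property.\<close>

lemma quantum_seed_torus:
  assumes "quantum_seed (t :: ('i::finite, 'k::division_ring) qseed)"
  shows "\<exists>d. quantum_torus t d"
proof -
  from assms have sk: "skew_field_of_fractions t" by (simp add: quantum_seed_def)
  then have inj: "inj (emb t)" and one: "emb t 1 = 1"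
    and mult: "\<And>P Q. emb t (twisted_mult (lam t) P Q) = emb t P * emb t Q"
    and frac: "\<And>x. \<exists>P Q. Q \<noteq> 0 \<and> x = emb t P * inverse (emb t Q)"
    by (auto simp: skew_field_of_fractions_def)
  have tm0: "tmon t 0 = 1"
    using one by (simp add: emb_def)
  have emb_single: "emb t (Poly_Mapping.single m p) = coef t p * tmon t m" for m p
    by (simp add: emb_lincomb lincomb_single coef_add)
  have tw: "twisted_mult \<Lambda> (Poly_Mapping.single m p) (Poly_Mapping.single m' q) =
      Poly_Mapping.single (m + m') (vpow (lam_form \<Lambda> m m') * p * q)"
    for \<Lambda> :: "int ^ 'i ^ 'i" and m m' p q
    by (cases "p = 0 \<or> q = 0") (auto simp: twisted_mult_def)
  \<comment> \<open>As \<open>inverse 0 = 0\<close>, the image of \<open>v * v^(-1) = 1\<close>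
    excludes \<open>vq t = 0\<close>.\<close>
  have "vq t * vq t powi (-1) = 1"
    using mult[of "Poly_Mapping.single 0 (vpow 1)" "Poly_Mapping.single 0 (vpow (-1))"]
    by (simp add: tw emb_single tm0 vpow_mult one)
  then have nz: "vq t \<noteq> 0" by auto
  have comm: "vq t * emb t P = emb t P * vq t" for P
  proof -
    have "twisted_mult (lam t) (Poly_Mapping.single 0 (vpow 1)) P = twisted_mult (lam t) P (Poly_Mapping.single 0 (vpow 1))"
      by (simp add: twisted_mult_def mult.commute)
    then have "emb t (Poly_Mapping.single 0 (vpow 1)) * emb t P = emb t P * emb t (Poly_Mapping.single 0 (vpow 1))"
      by (metis mult)
    then show ?thesis by (simp add: emb_single tm0)
  qed
  have central: "vq t * x = x * vq t" for x
  proof -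
    obtain P Q where x: "x = emb t P * inverse (emb t Q)" using frac by blast
    have "vq t * inverse (emb t Q) = inverse (emb t Q) * vq t"
      using comm[of Q] by (metis mult_commute_imp_mult_inverse_commute)
    then show ?thesis
      unfolding x by (metis comm mult.assoc)
  qed
  obtain d where d: "\<And>k. k \<in> uf t \<Longrightarrow> 0 < d k"
    "\<And>k j. k \<in> uf t \<Longrightarrow> (Finite_Cartesian_Product.transpose (bmat t) ** lam t) $ k $ j = (if k = j then d k else (0::int))"
    using assms unfolding quantum_seed_def by metis
  have compat: "lam_form (lam t) (bmat t *v axis k 1) m = d k * m $ k" if k: "k \<in> uf t" for k m
  proof -
    have "lam_form (lam t) (bmat t *v axis k 1) (axis j 1) = (if k = j then d k else 0)" for j
    proof -
      have "lam_form (lam t) (bmat t *v axis k 1) (axis j 1) = (\<Sum>i\<in>UNIV. bmat t $ i $ k * lam t $ i $ j)"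
        by (subst lam_form_expand_left) (simp add: matrix_vector_axis lam_form_axis)
      also have "\<dots> = (Finite_Cartesian_Product.transpose (bmat t) ** lam t) $ k $ j"
        by (simp add: matrix_matrix_mult_def Finite_Cartesian_Product.transpose_def)
      finally show ?thesis using d(2)[OF k] by simp
    qed
    then show ?thesis
      by (subst lam_form_expand_right) (simp add: if_distrib[of "(*) _"] cong: if_cong)
  qed
  have tmm: "tmon t m * tmon t m' = vq t powi lam_form (lam t) m m' * tmon t (m + m')" for m m'
    using mult[of "Poly_Mapping.single m 1" "Poly_Mapping.single m' 1"] by (simp add: tw emb_single)
  have "quantum_torus t d"
  proof (rule quantum_torus.intro)
    show "lam t $ j $ i = - lam t $ i $ j" for i j
      using assms unfolding quantum_seed_def by blast
  qed (use assms inj nz tm0 tmm d(1) compat central in \<open>blast | simp add: quantum_seed_def\<close>)+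
  then show ?thesis by blast
qed

subsection \<open>Mutation\<close>

lemma mutate_simps [simp]:
  "uf (mutate k t) = uf t" "vq (mutate k t) = vq t"
  "bmat (mutate k t) = mut_bmat k (bmat t)" "lam (mutate k t) = mut_lam k (bmat t) (lam t)"
  by (simp_all add: mutate_def)

lemma coef_mutate [simp]: "coef (mutate k t) = coef t"
  by (simp add: fun_eq_iff coef_def)

lemma axis_eq_scale: "axis k c = c *s axis k (1::int)"
  by (simp add: vec_eq_iff axis_def)

lemma axis_nth: "axis k c $ i = (if i = k then c else 0)"
  by (simp add: axis_def)

context quantum_torus
begin

text \<open>Both sides evaluate the pairing of columns \<open>k\<close> and \<open>a\<close> of
  \<open>bmat t\<close> under the skew form, in the two orders.\<close>

lemma bmat_skew:
  assumes "k \<in> uf t" "a \<in> uf t"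
  shows "d k * bmat t $ k $ a = - (d a * bmat t $ a $ k)"
proof -
  have "d k * bmat t $ k $ a = lam_form (lam t) (bmat t *v axis k 1) (bmat t *v axis a 1)"
    by (simp only: compat[OF assms(1)] matrix_vector_axis)
  also have "\<dots> = - lam_form (lam t) (bmat t *v axis a 1) (bmat t *v axis k 1)"
    by (rule lam_form_skew)
  also have "\<dots> = - (d a * bmat t $ a $ k)"
    by (simp only: compat[OF assms(2)] matrix_vector_axis)
  finally show ?thesis .
qed

lemma bmat_diag: "bmat t $ k $ k = 0"
proof (cases "k \<in> uf t")
  case True
  then show ?thesis using bmat_skew[OF True True] d_pos[OF True] by auto
qed (simp add: bmat_frozen)

lemma exp_minus_nth: "exp_minus k (bmat t) $ i = (if i = k then -1 else pos (- (bmat t $ i $ k)))"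
  by (simp add: exp_minus_def axis_nth bmat_diag)

lemma exp_plus_nth: "exp_plus k (bmat t) $ i = (if i = k then -1 else pos (bmat t $ i $ k))"
  by (simp add: exp_plus_def axis_nth bmat_diag)

lemma exp_plus_eq: "exp_plus k (bmat t) = exp_minus k (bmat t) + bmat t *v axis k 1"
  by (auto simp: vec_eq_iff exp_plus_nth exp_minus_nth matrix_vector_axis bmat_diag)

lemma exp_plus_neq:
  assumes "k \<in> uf t"
  shows "exp_plus k (bmat t) \<noteq> exp_minus k (bmat t)"
proof
  assume "exp_plus k (bmat t) = exp_minus k (bmat t)"
  then have "lam_form (lam t) (bmat t *v axis k 1) (axis k 1) = 0"
    by (simp add: exp_plus_eq)
  then show False using d_pos[OF assms] by (simp add: compat[OF assms])
qed

text \<open>The base change \<open>E\<close> of Berenstein and Zelevinsky, for which \<open>\<Lambda>' = E\<^sup>T \<Lambda> E\<close> and \<open>E B' = B F\<close>.\<close>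

definition E_change :: "'i \<Rightarrow> int ^ 'i \<Rightarrow> int ^ 'i" where
  "E_change k m = m - m $ k *s axis k 1 + m $ k *s exp_minus k (bmat t)"

lemma E_change_add: "E_change k (a + b) = E_change k a + E_change k b"
  by (simp add: E_change_def vec_eq_iff algebra_simps)

lemma E_change_scale: "E_change k (c *s a) = c *s E_change k a"
  by (simp add: E_change_def vec_eq_iff algebra_simps)

lemma E_change_sum: "E_change k (sum f S) = (\<Sum>x\<in>S. E_change k (f x))"
  by (induction S rule: infinite_finite_induct) (simp_all add: E_change_add, simp_all add: E_change_def)

lemma E_change_axis: "E_change k (axis i 1) = (if i = k then exp_minus k (bmat t) else axis i 1)"
  by (simp add: E_change_def axis_nth)

lemma E_change_nth:
  "E_change k m $ i = (if i = k then - (m $ k) else m $ i + m $ k * pos (- (bmat t $ i $ k)))"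
  by (simp add: E_change_def exp_minus_nth axis_nth)

lemma E_change_id: "m $ k = 0 \<Longrightarrow> E_change k m = m"
  by (simp add: E_change_def)

lemma lam_form_mut_lam:
  "lam_form (mut_lam k (bmat t) (lam t)) m m' = lam_form (lam t) (E_change k m) (E_change k m')"
proof -
  let ?L = "mut_lam k (bmat t) (lam t)"
  have "?L $ i $ j = lam_form (lam t) (E_change k (axis i 1)) (E_change k (axis j 1))" for i j
    by (simp add: mut_lam_def E_change_axis lam_form_axis)
       (metis lam_form_skew)
  then have ax: "lam_form ?L (axis i 1) (axis j 1) =
      lam_form (lam t) (E_change k (axis i 1)) (E_change k (axis j 1))" for i j
    by (simp add: lam_form_axis)
  have E: "E_change k x = (\<Sum>i\<in>UNIV. x $ i *s E_change k (axis i 1))" for x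
    using E_change_sum[of k "\<lambda>i. x $ i *s axis i 1" UNIV]
    by (simp add: E_change_scale flip: vec_sum_axis)
  have L: "lam_form (lam t) (E_change k m) x = (\<Sum>i\<in>UNIV. m $ i * lam_form (lam t) (E_change k (axis i 1)) x)" for x
    by (subst E) (simp add: lam_form_sum_left lam_form_scale_left)
  have R: "lam_form (lam t) x (E_change k m') = (\<Sum>i\<in>UNIV. m' $ i * lam_form (lam t) x (E_change k (axis i 1)))" for x
    by (subst E) (simp add: lam_form_sum_right lam_form_scale_right)
  have "lam_form ?L m m' = (\<Sum>i\<in>UNIV. m $ i * (\<Sum>j\<in>UNIV. m' $ j * lam_form ?L (axis i 1) (axis j 1)))"
    by (subst lam_form_expand_left, subst lam_form_expand_right[of _ _ m']) (rule refl)
  also have "\<dots> = (\<Sum>i\<in>UNIV. m $ i * (\<Sum>j\<in>UNIV. m' $ j * lam_form (lam t) (E_change k (axis i 1)) (E_change k (axis j 1))))"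
    by (simp add: ax)
  also have "\<dots> = lam_form (lam t) (E_change k m) (E_change k m')"
    by (subst L) (simp only: R)
  finally show ?thesis .
qed

text \<open>One column of \<open>E B' = B F\<close>, where \<open>F\<close> adds [b_ka]_+ times
  column \<open>k\<close> to column \<open>a\<close>. Entrywise it is the identity [x]_+ [y]_+ -
  [-x]_+ [-y]_+ - y [-x]_+ = x [y]_+ with x = b_ik and y = b_ka.\<close>

lemma E_change_mut_bmat:
  assumes "a \<noteq> k"
  shows "E_change k (mut_bmat k (bmat t) *v axis a 1) =
    bmat t *v axis a 1 + pos (bmat t $ k $ a) *s (bmat t *v axis k 1)"
proof -
  have p: "pos x - pos (- x) = x" for x :: int
    by auto
  have q: "C * A - C' * A' - b * C' = A * c" if "A - A' = b" "C - C' = c" for A A' C C' b c :: int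
    unfolding that[symmetric] by (simp add: algebra_simps)
  have "pos (bmat t $ i $ k) * pos (bmat t $ k $ a) - pos (- (bmat t $ i $ k)) * pos (- (bmat t $ k $ a))
      - bmat t $ k $ a * pos (- (bmat t $ i $ k)) = pos (bmat t $ k $ a) * bmat t $ i $ k" for i
    by (rule q) (rule p)+
  then show ?thesis
    using assms by (simp add: vec_eq_iff E_change_nth matrix_vector_axis mut_bmat_def bmat_diag
        algebra_simps)
qed

lemma E_change_mut_bmat_same:
  "E_change k (mut_bmat k (bmat t) *v axis k 1) = - (bmat t *v axis k 1)"
  by (simp add: vec_eq_iff E_change_nth matrix_vector_axis mut_bmat_def bmat_diag)

text \<open>After pulling back by \<open>E_change\<close>, the extra column \<open>k\<close>
  contributes - d_k [b_ka]_+ m_k and the changed entry \<open>a\<close> contributes d_a [-b_ak]_+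
  m_k; \<open>bmat_skew\<close> makes them cancel. So \<open>d\<close> is unchanged by
  mutation.\<close>

lemma compat_mutate:
  assumes "k \<in> uf t" "a \<in> uf t"
  shows "lam_form (mut_lam k (bmat t) (lam t)) (mut_bmat k (bmat t) *v axis a 1) m = d a * m $ a"
proof (cases "a = k")
  case True
  then show ?thesis
    by (simp add: lam_form_mut_lam E_change_mut_bmat_same lam_form_minus_left compat assms E_change_nth)
next
  case False
  have "d k * pos (bmat t $ k $ a) = pos (d k * bmat t $ k $ a)"
    using d_pos[OF assms(1)] by (simp add: max_def zero_le_mult_iff mult_le_0_iff)
  also have "\<dots> = pos (d a * (- (bmat t $ a $ k)))"
    using bmat_skew[OF assms] by simp
  also have "\<dots> = d a * pos (- (bmat t $ a $ k))"
    using d_pos[OF assms(2)] by (simp add: max_def zero_le_mult_iff mult_le_0_iff)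
  finally have eq: "d k * pos (bmat t $ k $ a) = d a * pos (- (bmat t $ a $ k))" .
  show ?thesis using False eq
    by (simp add: lam_form_mut_lam E_change_mut_bmat lam_form_add_left lam_form_scale_left
        compat assms E_change_nth algebra_simps)
qed

lemma new_var_emb: "new_var k t = emb t (Poly_Mapping.single (exp_minus k (bmat t)) 1 +
     Poly_Mapping.single (exp_plus k (bmat t)) 1)"
  by (simp add: new_var_def emb_rules)

lemma new_var_neq_0:
  assumes "k \<in> uf t"
  shows "new_var k t \<noteq> 0"
proof -
  have "Poly_Mapping.lookup (Poly_Mapping.single (exp_minus k (bmat t)) 1 +
     Poly_Mapping.single (exp_plus k (bmat t)) (1::zv)) (exp_minus k (bmat t)) \<noteq> 0"
    using exp_plus_neq[OF assms] by (simp add: lookup_add lookup_single)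
  then show ?thesis
    unfolding new_var_emb emb_eq_0_iff by (metis lookup_zero)
qed

text \<open>The two exponents of the new variable differ by column \<open>k\<close> of
  \<open>bmat t\<close>, which pairs to zero with \<open>m\<close> because \<open>m $ k = 0\<close>.
  Both monomials thus exchange with \<open>tmon t m\<close> at the cost of the same power of
  \<open>v\<close>.\<close>

lemma new_var_tmon:
  assumes "k \<in> uf t" "m $ k = 0"
  shows "new_var k t * tmon t m = vq t powi (2 * lam_form (lam t) (exp_minus k (bmat t)) m) * tmon t m * new_var k t"
proof -
  let ?e = "exp_minus k (bmat t)" and ?f = "exp_plus k (bmat t)"
  have ef: "lam_form (lam t) ?f m = lam_form (lam t) ?e m"
    using assms by (simp add: exp_plus_eq lam_form_add_left compat)
  have q: "tmon t e * tmon t m = vq t powi (2 * lam_form (lam t) e m) * tmon t m * tmon t e" for e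
  proof -
    have "tmon t m * tmon t e = vq t powi (- lam_form (lam t) e m) * tmon t (e + m)"
      by (simp add: tmon_mult lam_form_skew[of m e] add.commute)
    then have "vq t powi (2 * lam_form (lam t) e m) * (tmon t m * tmon t e) =
        vq t powi (2 * lam_form (lam t) e m - lam_form (lam t) e m) * tmon t (e + m)"
      by (simp only: powi_add diff_conv_add_uminus mult.assoc)
    then show ?thesis
      by (simp add: tmon_mult mult.assoc)
  qed
  show ?thesis
    unfolding new_var_def by (simp add: distrib_left distrib_right q ef)
qed

lemma new_var_powi_tmon:
  assumes "k \<in> uf t" "m $ k = 0"
  shows "new_var k t powi j * tmon t m =
    vq t powi (2 * j * lam_form (lam t) (exp_minus k (bmat t)) m) * tmon t m * new_var k t powi j"
proof -
  have "new_var k t powi j * tmon t m = (vq t powi (2 * lam_form (lam t) (exp_minus k (bmat t)) m)) powi j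
      * tmon t m * new_var k t powi j"
    by (rule powi_qcommute)
      (use powi_central vq_neq_0 new_var_neq_0[OF assms(1)] new_var_tmon[OF assms] in auto)
  then show ?thesis
    by (simp add: mult_ac flip: power_int_mult)
qed

lemma tmon_mutate':
  "tmon (mutate k t) m = vq t powi (- (m $ k * lam_form (mut_lam k (bmat t) (lam t)) (m - m $ k *s axis k 1) (axis k 1)))
     * tmon t (m - m $ k *s axis k 1) * new_var k t powi (m $ k)"
  by (simp add: tmon_mutate axis_eq_scale[of k "m $ k"] lam_form_scale_right)

text \<open>With exponents split as \<open>m0 + j *s f\<close>, the only exchange needed is that of
  \<open>y powi j\<close> with \<open>tmon t m0'\<close>. It costs
  \<open>v^(2 j \<lambda>'(f, m0'))\<close>, and the remaining factors multiply in the old torus;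
  collecting powers of \<open>v\<close> gives the mutated form.\<close>

lemma tmon_mult_mutate:
  assumes k: "k \<in> uf t"
  shows "tmon (mutate k t) m * tmon (mutate k t) m' =
    vq t powi lam_form (mut_lam k (bmat t) (lam t)) m m' * tmon (mutate k t) (m + m')"
proof -
  let ?L = "lam_form (mut_lam k (bmat t) (lam t))" and ?v = "\<lambda>n. vq t powi n"
  define f y j j' m0 m0' where "f = (axis k 1 :: int ^ 'i)" and "y = new_var k t"
    and "j = m $ k" and "j' = m' $ k" and "m0 = m - j *s f" and "m0' = m' - j' *s f"
  have m: "m = m0 + j *s f" "m' = m0' + j' *s f" by (simp_all add: m0_def m0'_def)
  have zero: "m0 $ k = 0" "m0' $ k = 0"
    by (simp_all add: m0_def m0'_def f_def j_def j'_def axis_nth)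
  have Ls: "?L a b = - ?L b a" for a b
    unfolding lam_form_mut_lam by (rule lam_form_skew)
  have L0: "lam_form (lam t) m0 m0' = ?L m0 m0'"
    by (simp add: lam_form_mut_lam E_change_id zero)
  have Lf: "lam_form (lam t) (exp_minus k (bmat t)) m0' = ?L f m0'"
    by (simp add: lam_form_mut_lam E_change_id zero f_def E_change_axis)
  have Lff: "?L f f = 0" using Ls[of f f] by simp
  have y0: "y \<noteq> 0" using new_var_neq_0[OF k] by (simp add: y_def)
  have x: "tmon (mutate k t) m = ?v (- (j * ?L m0 f)) * tmon t m0 * y powi j"
    "tmon (mutate k t) m' = ?v (- (j' * ?L m0' f)) * tmon t m0' * y powi j'"
    by (simp_all add: tmon_mutate' j_def j'_def m0_def m0'_def f_def y_def)
  have sum: "m + m' - (j + j') *s f = m0 + m0'" "(m + m') $ k = j + j'"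
    by (simp_all add: m0_def m0'_def j_def j'_def vec_eq_iff algebra_simps)
  have xx: "tmon (mutate k t) (m + m') = ?v (- ((j + j') * ?L (m0 + m0') f)) * tmon t (m0 + m0') * y powi (j + j')"
    unfolding tmon_mutate'[of k "m + m'"] f_def[symmetric] sum y_def by (rule refl)
  have cent: "x * (?v n * z) = ?v n * (x * z)" for x z n
    by (metis powi_central mult.assoc)
  have "tmon (mutate k t) m * tmon (mutate k t) m' =
     ?v (- (j * ?L m0 f)) * ?v (- (j' * ?L m0' f)) * (tmon t m0 * (y powi j * tmon t m0') * y powi j')"
    by (simp only: x mult.assoc cent[of "tmon t _"] cent[of "y powi _"])
  also have "\<dots> = ?v (- (j * ?L m0 f)) * ?v (- (j' * ?L m0' f)) *
      (tmon t m0 * (?v (2 * j * ?L f m0') * tmon t m0' * y powi j) * y powi j')"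
    using new_var_powi_tmon[OF k zero(2), of j] by (simp add: Lf y_def)
  also have "\<dots> = ?v (- (j * ?L m0 f)) * ?v (- (j' * ?L m0' f)) * ?v (2 * j * ?L f m0') *
      (tmon t m0 * tmon t m0' * y powi (j + j'))"
    by (simp only: power_int_add[OF disjI1[OF y0]] mult.assoc cent[of "tmon t _"] cent[of "y powi _"])
  also have "\<dots> = ?v (- (j * ?L m0 f)) * ?v (- (j' * ?L m0' f)) * ?v (2 * j * ?L f m0') * ?v (?L m0 m0') *
      (tmon t (m0 + m0') * y powi (j + j'))"
    by (simp add: tmon_mult L0 mult.assoc)
  also have "\<dots> = ?v (- (j * ?L m0 f) - j' * ?L m0' f + 2 * j * ?L f m0' + ?L m0 m0') *
      (tmon t (m0 + m0') * y powi (j + j'))"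
    by (simp only: powi_add diff_conv_add_uminus)
  also have "- (j * ?L m0 f) - j' * ?L m0' f + 2 * j * ?L f m0' + ?L m0 m0' =
     ?L m m' + - ((j + j') * ?L (m0 + m0') f)"
    unfolding m by (simp add: lam_form_add_left lam_form_add_right lam_form_scale_left
        lam_form_scale_right Lff Ls[of f m0'] algebra_simps)
  also have "?v (?L m m' + - ((j + j') * ?L (m0 + m0') f)) * (tmon t (m0 + m0') * y powi (j + j')) =
    ?v (?L m m') * tmon (mutate k t) (m + m')"
    by (simp only: powi_add xx mult.assoc)
  finally show ?thesis .
qed

section \<open>Injectivity after mutation, through the grading by the k-th exponent\<close>

definition homogeneous :: "'i \<Rightarrow> int \<Rightarrow> 'k \<Rightarrow> bool" where
  "homogeneous k j x \<longleftrightarrow> (\<exists>P. emb t P = x \<and> (\<forall>m\<in>Poly_Mapping.keys P. m $ k = j))"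

lemma homogeneous_mult:
  assumes "homogeneous k a x" "homogeneous k b y"
  shows "homogeneous k (a + b) (x * y)"
proof -
  obtain P Q where "emb t P = x" "\<forall>m\<in>Poly_Mapping.keys P. m $ k = a"
    and "emb t Q = y" "\<forall>m\<in>Poly_Mapping.keys Q. m $ k = b"
    using assms unfolding homogeneous_def by blast
  then show ?thesis
    unfolding homogeneous_def
    by (intro exI[of _ "twisted_mult (lam t) P Q"])
       (use keys_twisted_mult[of "lam t" P Q] in \<open>fastforce simp: emb_twisted_mult\<close>)
qed

lemma homogeneous_1: "homogeneous k 0 1"
  unfolding homogeneous_def
  by (rule exI[of _ "Poly_Mapping.single 0 1"]) (simp add: emb_rules tmon_0 del: single_one)

lemma homogeneous_new_var: "homogeneous k (-1) (new_var k t)"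
proof -
  let ?P = "Poly_Mapping.single (exp_minus k (bmat t)) 1 + Poly_Mapping.single (exp_plus k (bmat t)) (1::zv)"
  have "Poly_Mapping.keys ?P \<subseteq> {exp_minus k (bmat t), exp_plus k (bmat t)}"
    using keys_add[of "Poly_Mapping.single (exp_minus k (bmat t)) (1::zv)" "Poly_Mapping.single (exp_plus k (bmat t)) 1"]
    by auto
  then have "\<forall>m\<in>Poly_Mapping.keys ?P. m $ k = -1"
    using exp_minus_nth[of k k] exp_plus_nth[of k k] by auto
  then show ?thesis
    unfolding homogeneous_def new_var_emb by blast
qed

lemma homogeneous_new_var_power: "homogeneous k (- int n) (new_var k t ^ n)"
proof (induction n)
  case (Suc n)
  then show ?case
    using homogeneous_mult[OF homogeneous_new_var Suc] by simp
qed (simp add: homogeneous_1)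

lemma homogeneous_sum_eq_0:
  assumes "finite S" "inj_on e S" "\<And>j. j \<in> S \<Longrightarrow> homogeneous k (e j) (z j)" "(\<Sum>j\<in>S. z j) = 0"
    and "j \<in> S"
  shows "z j = 0"
proof -
  obtain P where P: "\<And>j. j \<in> S \<Longrightarrow> emb t (P j) = z j"
    "\<And>j m. j \<in> S \<Longrightarrow> m \<in> Poly_Mapping.keys (P j) \<Longrightarrow> m $ k = e j"
    using assms(3) unfolding homogeneous_def by metis
  have "emb t (\<Sum>j\<in>S. P j) = (\<Sum>j\<in>S. z j)"
    by (simp add: emb_rules P)
  then have 0: "(\<Sum>j\<in>S. P j) = 0"
    using assms(4) emb_eq_0_iff by simp
  have "Poly_Mapping.lookup (P j) m = 0" for m
  proof (rule ccontr)
    assume nz: "Poly_Mapping.lookup (P j) m \<noteq> 0"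
    have "Poly_Mapping.lookup (P i) m = 0" if "i \<in> S - {j}" for i
    proof (rule ccontr)
      assume "Poly_Mapping.lookup (P i) m \<noteq> 0"
      then have "m $ k = e i" "m $ k = e j"
        using P(2)[of i m] P(2)[of j m] nz that assms(5) by (simp_all add: in_keys_iff)
      then show False using assms(2,5) that by (metis DiffD1 DiffD2 inj_onD singletonI)
    qed
    then have "Poly_Mapping.lookup (\<Sum>i\<in>S. P i) m = Poly_Mapping.lookup (P j) m"
      by (subst lookup_sum, subst sum.remove[OF assms(1,5)]) simp
    with nz 0 show False by simp
  qed
  then have "P j = 0" by (intro poly_mapping_eqI) simp
  then show ?thesis using P(1)[OF assms(5)] by (simp add: emb_rules)
qed

text \<open>Both monomials of the new variable have \<open>k\<close>-degree \<open>-1\<close>, so an expansion in its powers can be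
  compared degree by degree.\<close>

lemma emb_mutate_eq_0:
  assumes k: "k \<in> uf t" and 0: "emb (mutate k t) P = 0"
  shows "P = 0"
proof -
  define y where "y = new_var k t"
  have y0: "y \<noteq> 0" using new_var_neq_0[OF k] by (simp add: y_def)
  define p where "p m = m - m $ k *s (axis k 1 :: int ^ 'i)" for m :: "int ^ 'i"
  have pk: "p m $ k = 0" for m by (simp add: p_def axis_nth)
  define a where "a m = - (m $ k * lam_form (mut_lam k (bmat t) (lam t)) (p m) (axis k 1))" for m
  define S where "S = (\<lambda>m. m $ k) ` Poly_Mapping.keys P"
  have fS: "finite S" by (simp add: S_def)
  define Q where "Q j = (\<Sum>m | m \<in> Poly_Mapping.keys P \<and> m $ k = j.
      Poly_Mapping.single (p m) (Poly_Mapping.lookup P m * vpow (a m)))" for j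
  \<comment> \<open>Multiplying by \<open>y ^ N\<close> clears the negative powers of
    \<open>y\<close>, since homogeneity is available for natural powers only:
    \<open>inverse y\<close> need not be a Laurent polynomial.\<close>
  obtain N :: nat where N: "\<And>j. j \<in> S \<Longrightarrow> 0 \<le> j + int N"
  proof
    show "0 \<le> j + int (\<Sum>j\<in>S. nat \<bar>j\<bar>)" if "j \<in> S" for j
      using member_le_sum[of j S "\<lambda>j. \<bar>j\<bar>"] fS that by simp
  qed
  have embQ: "emb t (Q j) = (\<Sum>m | m \<in> Poly_Mapping.keys P \<and> m $ k = j.
      coef t (Poly_Mapping.lookup P m) * vq t powi (a m) * tmon t (p m))" for j
    by (simp add: Q_def emb_rules coef_mult)
  have homQ: "homogeneous k 0 (emb t (Q j))" for j
  proof -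
    have "m $ k = 0" if "m \<in> Poly_Mapping.keys (Q j)" for m
    proof -
      have "m \<in> (\<Union>m'\<in>{m \<in> Poly_Mapping.keys P. m $ k = j}. Poly_Mapping.keys
          (Poly_Mapping.single (p m') (Poly_Mapping.lookup P m' * vpow (a m'))))"
      proof (rule ccontr)
        assume "\<not> ?thesis"
        then have "Poly_Mapping.lookup (Q j) m = 0"
          unfolding Q_def lookup_sum by (intro sum.neutral) (auto simp: in_keys_iff lookup_single when_def)
        then show False using that by (simp add: in_keys_iff)
      qed
      then show ?thesis using pk by (auto split: if_splits)
    qed
    then show ?thesis unfolding homogeneous_def by blast
  qed
  have "emb (mutate k t) P = (\<Sum>m\<in>Poly_Mapping.keys P.
       coef t (Poly_Mapping.lookup P m) * vq t powi (a m) * tmon t (p m) * y powi (m $ k))"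
    unfolding emb_def tmon_mutate' by (simp add: a_def p_def y_def mult.assoc)
  also have "\<dots> = (\<Sum>j\<in>S. \<Sum>m | m \<in> Poly_Mapping.keys P \<and> m $ k = j.
      coef t (Poly_Mapping.lookup P m) * vq t powi (a m) * tmon t (p m) * y powi (m $ k))"
    unfolding S_def by (rule sum.image_gen) simp
  also have "\<dots> = (\<Sum>j\<in>S. emb t (Q j) * y powi j)"
    by (simp add: embQ sum_distrib_right)
  finally have "(\<Sum>j\<in>S. emb t (Q j) * y powi j) = 0" using 0 by simp
  then have "(\<Sum>j\<in>S. emb t (Q j) * y powi j) * y ^ N = 0" by simp
  then have sum0: "(\<Sum>j\<in>S. emb t (Q j) * y ^ nat (j + int N)) = 0"
    using y0 N by (simp add: sum_distrib_right mult.assoc power_int_add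
        flip: power_int_of_nat)
  have Q0: "Q j = 0" if "j \<in> S" for j
  proof -
    have "emb t (Q j) * y ^ nat (j + int N) = 0"
    proof (rule homogeneous_sum_eq_0[OF fS _ _ sum0 that, of "\<lambda>j. 0 + - int (nat (j + int N))"])
      show "inj_on (\<lambda>j. 0 + - int (nat (j + int N))) S"
        using N by (auto simp: inj_on_def)
      show "homogeneous k (0 + - int (nat (i + int N))) (emb t (Q i) * y ^ nat (i + int N))" for i
        unfolding y_def by (rule homogeneous_mult[OF homQ homogeneous_new_var_power])
    qed
    then show ?thesis using y0 emb_eq_0_iff by simp
  qed
  \<comment> \<open>Within one \<open>k\<close>-degree the projection \<open>p\<close> is injective,
    so the terms of \<open>Q j\<close> do not collide and each coefficient of \<open>P\<close> can
    be read off up to a power of \<open>v\<close>.\<close>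
  have inj: "m = m'" if "p m = p m'" "m $ k = m' $ k" for m m'
    using that by (simp add: p_def)
  have "Poly_Mapping.lookup P m = 0" for m
  proof (rule ccontr)
    assume nz: "Poly_Mapping.lookup P m \<noteq> 0"
    let ?T = "{m' \<in> Poly_Mapping.keys P. m' $ k = m $ k}"
    have m: "m \<in> ?T" using nz by (simp add: in_keys_iff)
    have "Poly_Mapping.lookup (Q (m $ k)) (p m) =
       (\<Sum>m'\<in>?T. if m' = m then Poly_Mapping.lookup P m * vpow (a m) else 0)"
      unfolding Q_def lookup_sum
      by (intro sum.cong refl) (auto simp: lookup_single when_def dest: inj)
    also have "\<dots> = Poly_Mapping.lookup P m * vpow (a m)"
      using m by simp
    finally have "Poly_Mapping.lookup P m * vpow (a m) = 0"
      using Q0[of "m $ k"] m by (simp add: S_def)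
    then have "Poly_Mapping.lookup P m * vpow (a m) * vpow (- a m) = 0" by simp
    with nz show False by (simp add: mult.assoc vpow_mult)
  qed
  then show ?thesis by (intro poly_mapping_eqI) simp
qed

lemma quantum_torus_mutate:
  assumes k: "k \<in> uf t"
  shows "quantum_torus (mutate k t) d"
proof (rule quantum_torus.intro)
  show "inj (emb (mutate k t))"
  proof (rule injI)
    fix P Q assume "emb (mutate k t) P = emb (mutate k t) Q"
    then have "emb (mutate k t) (P - Q) = 0"
      by (simp add: emb_lincomb lincomb_diff coef_add)
    then show "P = Q" using emb_mutate_eq_0[OF k] by fastforce
  qed
  show "tmon (mutate k t) 0 = 1"
    by (simp add: tmon_mutate' tmon_0)
  show "lam (mutate k t) $ j $ i = - lam (mutate k t) $ i $ j" for i j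
    using lam_form_skew[of "E_change k (axis j 1)" "E_change k (axis i 1)"]
    by (simp add: lam_form_mut_lam flip: lam_form_axis)
  show "bmat (mutate k t) $ i $ j = 0" if "j \<notin> uf (mutate k t)" for i j
    using that by (simp add: mut_bmat_def bmat_frozen)
  show "vq (mutate k t) * x = x * vq (mutate k t)" for x
    using vq_central by simp
qed (simp_all add: vq_neq_0 d_pos tmon_mult_mutate[OF k] compat_mutate[OF k])

end

lemma mutate_seq_simps [simp]:
  "uf (mutate_seq ks t) = uf t" "vq (mutate_seq ks t) = vq t"
  by (induction ks arbitrary: t) simp_all

lemma coef_mutate_seq [simp]: "coef (mutate_seq ks t) = coef t"
  by (simp add: fun_eq_iff coef_def)

lemma quantum_torus_mutate_seq:
  assumes "quantum_torus t d" "set ks \<subseteq> uf t"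
  shows "quantum_torus (mutate_seq ks t) d"
  using assms
proof (induction ks arbitrary: t)
  case (Cons k ks)
  then show ?case
    using quantum_torus.quantum_torus_mutate[OF Cons.prems(1), of k] by simp
qed simp

subsection \<open>Triangular bases\<close>

lemma int_vec_sum_induct:
  fixes P :: "int ^ 'i::finite \<Rightarrow> bool"
  assumes "P 0" "\<And>a b. P a \<Longrightarrow> P b \<Longrightarrow> P (a + b)" "\<And>i. P (m $ i *s axis i 1)"
  shows "P m"
proof -
  have "P (\<Sum>i\<in>S. m $ i *s axis i 1)" for S
    by (induction S rule: infinite_finite_induct) (simp_all add: assms)
  then show ?thesis by (metis vec_sum_axis)
qed

context quantum_torus
begin

lemma module_zv_scale: "module (zv_scale t)"
  by unfold_locales (simp_all add: zv_scale_def distrib_left distrib_right coef_add coef_mult mult.assoc)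

lemma vpow_eq_1D: "vpow n = 1 \<Longrightarrow> n = 0"
  unfolding vpow_def using inj_single[of "1::int"] by (metis keys_single keys_one singleton_inject zero_neq_one)

lemma pointed_scaled:
  assumes "pointed t g x" "pointed t g' (vq t powi n * x)"
  shows "g = g'" "n = 0"
proof -
  obtain P where P: "emb t P = x" "lp_has_degree t P g" "Poly_Mapping.lookup P g = 1"
    using assms(1) unfolding pointed_def by blast
  obtain Q where Q: "emb t Q = vq t powi n * x" "lp_has_degree t Q g'" "Poly_Mapping.lookup Q g' = 1"
    using assms(2) unfolding pointed_def by blast
  have "emb t Q = emb t (Poly_Mapping.single 0 (vpow n) * P)"
    by (simp add: Q P emb_scale)
  then have QP: "Q = Poly_Mapping.single 0 (vpow n) * P"
    by (simp add: emb_eq_iff)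
  have "Poly_Mapping.keys Q = Poly_Mapping.keys P"
  proof -
    have "vpow n * p = 0 \<longleftrightarrow> p = 0" for p
    proof
      assume "vpow n * p = 0"
      then have "vpow (- n) * (vpow n * p) = 0" by simp
      then show "p = 0" by (simp add: vpow_mult flip: mult.assoc)
    qed simp
    then show ?thesis by (auto simp: QP in_keys_iff)
  qed
  then show g: "g = g'"
    using P(2) Q(2) by (simp add: lp_has_degree_def)
  show "n = 0"
    using Q(3) P(3) by (intro vpow_eq_1D) (simp add: QP g)
qed

end

text \<open>Coefficients are indexed by the elements of \<open>L\<close> and not by degrees, because
  two seeds index the same \<open>L\<close> by different degrees and their expansions have to be
  compared.\<close>

lemma sum_over_basis_unique:
  assumes "module (zv_scale t)" "zv_basis t A L"
    and "finite {W. b W \<noteq> 0}" "{W. b W \<noteq> 0} \<subseteq> L" "finite {W. c W \<noteq> 0}" "{W. c W \<noteq> 0} \<subseteq> L"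
    and "(\<Sum>W | b W \<noteq> 0. coef t (b W) * W) = (\<Sum>W | c W \<noteq> 0. coef t (c W) * W)"
  shows "b = c"
proof -
  interpret module "zv_scale t" by fact
  let ?S = "{W. b W \<noteq> 0} \<union> {W. c W \<noteq> 0}"
  have fin: "finite ?S" and sub: "?S \<subseteq> L" using assms by auto
  have "(\<Sum>W | b W \<noteq> 0. coef t (b W) * W) = (\<Sum>W\<in>?S. coef t (b W) * W)"
    by (rule sum.mono_neutral_left) (use fin in auto)
  moreover have "(\<Sum>W | c W \<noteq> 0. coef t (c W) * W) = (\<Sum>W\<in>?S. coef t (c W) * W)"
    by (rule sum.mono_neutral_left) (use fin in auto)
  ultimately have "(\<Sum>W\<in>?S. zv_scale t (b W - c W) W) = 0"
    using assms(7) by (simp add: zv_scale_def coef_diff left_diff_distrib sum_subtractf)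
  moreover have "\<not> dependent L"
    using assms(2) by (simp add: zv_basis_def)
  ultimately have "b W - c W = 0" if "W \<in> ?S" for W
    using independentD[OF _ fin sub _ that, of "\<lambda>W. b W - c W"] by blast
  then show ?thesis by (force simp: fun_eq_iff)
qed

text \<open>One seed's view of the basis: \<open>A\<close> and \<open>L\<close> stay fixed when the
  seed changes, while the indexing \<open>Lg\<close> by degrees belongs to the seed
  \<open>t\<close>.\<close>

locale triangular = quantum_torus t d
  for t :: "('i::finite, 'k::division_ring) qseed" and d :: "'i \<Rightarrow> int" +
  fixes A L :: "'k set" and Lg :: "int ^ 'i \<Rightarrow> 'k"
  assumes subalgebra: "zv_subalgebra t A"
    and basis: "zv_basis t A L"
    and range_Lg: "L = range Lg"
    and pointed_Lg: "pointed t g (Lg g)"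
    and bar_invariant_L: "Z \<in> L \<Longrightarrow> bar_invariant t Z"
    and triangular_axiom: "\<exists>b :: (int ^ 'i) \<Rightarrow>\<^sub>0 zv.
           normalized t (tmon t (axis i 1) * Lg g) =
             (\<Sum>g'\<in>Poly_Mapping.keys b. coef t (Poly_Mapping.lookup b g') * Lg g') \<and>
           (\<forall>g'\<in>Poly_Mapping.keys b. dom_le t g' (g + axis i 1)) \<and>
           Poly_Mapping.lookup b (g + axis i 1) = 1 \<and>
           (\<forall>g'. dom_less t g' (g + axis i 1) \<longrightarrow> Poly_Mapping.lookup b g' \<in> zv_le (- 1))"
    and tmon_axis_L: "tmon t (axis i 1) \<in> L"
begin

sublocale zv_mod: module "zv_scale t"
  by (rule module_zv_scale)

lemma Lg_in_L [simp]: "Lg g \<in> L"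
  by (simp add: range_Lg)

lemma Lg_eq_iff: "Lg g = Lg h \<longleftrightarrow> g = h"
  using pointed_unique pointed_Lg by metis

lemma L_pointedE:
  assumes "Z \<in> L" "pointed t g Z"
  shows "Z = Lg g"
  using assms pointed_unique[OF _ pointed_Lg] by (auto simp: range_Lg)

lemma A_add: "x \<in> A \<Longrightarrow> y \<in> A \<Longrightarrow> x + y \<in> A"
  using subalgebra zv_mod.subspace_add by (simp add: zv_subalgebra_def)

lemma A_scale: "x \<in> A \<Longrightarrow> coef t p * x \<in> A"
  using subalgebra zv_mod.subspace_scale[of A x p] by (simp add: zv_subalgebra_def zv_scale_def)

lemma A_0: "0 \<in> A"
  using subalgebra zv_mod.subspace_0 by (simp add: zv_subalgebra_def)

lemma A_sum: "(\<And>x. x \<in> S \<Longrightarrow> f x \<in> A) \<Longrightarrow> sum f S \<in> A"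
  by (induction S rule: infinite_finite_induct) (simp_all add: A_0 A_add)

lemma A_mult: "x \<in> A \<Longrightarrow> y \<in> A \<Longrightarrow> x * y \<in> A"
  using subalgebra by (simp add: zv_subalgebra_def)

lemma L_subset_A: "Z \<in> L \<Longrightarrow> Z \<in> A"
  using basis zv_mod.span_base by (auto simp: zv_basis_def)

abbreviation expand :: "'i lp \<Rightarrow> 'k" where
  "expand \<equiv> lincomb (coef t) Lg"

lemmas expand_rules = lincomb_rules[where X = Lg]

lemma expand_in_A: "expand b \<in> A"
  unfolding lincomb_def by (intro A_sum A_scale L_subset_A Lg_in_L)

lemma expand_eq_0D:
  assumes "expand b = 0"
  shows "b = 0"
proof -
  have inj: "inj Lg" by (simp add: inj_def Lg_eq_iff)
  have ind: "zv_mod.independent L"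
    using basis by (simp add: zv_basis_def)
  have "(\<Sum>Z\<in>Lg ` Poly_Mapping.keys b. zv_scale t (Poly_Mapping.lookup b (inv Lg Z)) Z) = expand b"
    by (simp add: sum.reindex[OF inj_on_subset[OF inj subset_UNIV]] lincomb_def zv_scale_def inv_f_f[OF inj])
  then have "Poly_Mapping.lookup b (inv Lg Z) = 0" if "Z \<in> Lg ` Poly_Mapping.keys b" for Z
    using zv_mod.independentD[OF ind _ _ _ that, of "\<lambda>Z. Poly_Mapping.lookup b (inv Lg Z)"] assms
    by (simp add: image_subset_iff)
  then have "Poly_Mapping.lookup b g = 0" if "g \<in> Poly_Mapping.keys b" for g
    using that inv_f_f[OF inj] by (metis imageI)
  then show ?thesis
    by (intro keys_eq_empty[THEN iffD1] equals0I) (auto simp: in_keys_iff)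
qed

lemma inj_expand: "inj expand"
proof (rule injI)
  fix b c assume "expand b = expand c"
  then have "expand (b - c) = 0" by (simp add: expand_rules)
  then show "b = c" using expand_eq_0D by fastforce
qed

lemma A_eq_range: "A = range expand"
proof
  have "zv_mod.span L \<subseteq> range expand"
  proof (rule zv_mod.span_minimal)
    show "L \<subseteq> range expand"
    proof
      fix Z assume "Z \<in> L"
      then obtain g where "Z = Lg g" by (auto simp: range_Lg)
      then have "Z = expand (Poly_Mapping.single g 1)" by (simp add: expand_rules)
      then show "Z \<in> range expand" by blast
    qed
    show "zv_mod.subspace (range expand)"
    proof (rule zv_mod.subspaceI)
      show "0 \<in> range expand" by (metis expand_rules(5) rangeI)
    next
      fix x y assume "x \<in> range expand" "y \<in> range expand"
      then show "x + y \<in> range expand" by (auto simp flip: expand_rules(1))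
    next
      fix p x assume "x \<in> range expand"
      then show "zv_scale t p x \<in> range expand" by (auto simp: zv_scale_def simp flip: expand_rules(6))
    qed
  qed
  then show "A \<subseteq> range expand" using basis by (simp add: zv_basis_def)
  show "range expand \<subseteq> A" using expand_in_A by blast
qed

section \<open>Coordinates with respect to the basis\<close>

definition coords :: "'k \<Rightarrow> 'i lp" where
  "coords = inv expand"

abbreviation coord :: "'k \<Rightarrow> int ^ 'i \<Rightarrow> zv" where
  "coord Z \<equiv> Poly_Mapping.lookup (coords Z)"

lemma coords_expand [simp]: "coords (expand b) = b"
  by (simp add: coords_def inj_expand)

lemma expand_coords: "Z \<in> A \<Longrightarrow> expand (coords Z) = Z"
  by (simp add: coords_def A_eq_range f_inv_into_f)

lemma coords_add: "x \<in> A \<Longrightarrow> y \<in> A \<Longrightarrow> coords (x + y) = coords x + coords y"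
  by (metis coords_expand expand_coords expand_rules(1))

lemma coords_scale: "x \<in> A \<Longrightarrow> coords (coef t p * x) = Poly_Mapping.single 0 p * coords x"
  by (metis coords_expand expand_coords expand_rules(6))

lemma coords_sum: "(\<And>x. x \<in> S \<Longrightarrow> f x \<in> A) \<Longrightarrow> coords (sum f S) = (\<Sum>x\<in>S. coords (f x))"
proof (induction S rule: infinite_finite_induct)
  case (infinite S)
  then show ?case by simp (metis coords_expand expand_rules(5))
next
  case empty
  then show ?case by simp (metis coords_expand expand_rules(5))
qed (simp add: coords_add A_sum)

lemma coords_Lg: "coords (Lg g) = Poly_Mapping.single g 1"
  using coords_expand[of "Poly_Mapping.single g 1"] by (simp add: expand_rules)

lemma expansion: "Z \<in> A \<Longrightarrow> Z = (\<Sum>h\<in>Poly_Mapping.keys (coords Z). coef t (coord Z h) * Lg h)"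
  using expand_coords by (simp add: lincomb_def)

lemma coord_combination:
  assumes "\<And>h. h \<in> Poly_Mapping.keys b \<Longrightarrow> F h \<in> A"
  shows "(\<Sum>h\<in>Poly_Mapping.keys b. coef t (Poly_Mapping.lookup b h) * F h) \<in> A"
    and "coord (\<Sum>h\<in>Poly_Mapping.keys b. coef t (Poly_Mapping.lookup b h) * F h) k =
      (\<Sum>h\<in>Poly_Mapping.keys b. Poly_Mapping.lookup b h * coord (F h) k)"
  by (simp_all add: A_sum A_scale assms coords_sum coords_scale lookup_sum)

text \<open>A degree that is maximal among the basis elements occurring comes from a single one of
  them, so it survives as an exponent of \<open>P\<close> with the same coefficient. Every degree
  that occurs lies below such a maximal one, hence below \<open>g\<close>.\<close>

lemma expansion_support:
  assumes "emb t P \<in> A" and le: "\<And>m. m \<in> Poly_Mapping.keys P \<Longrightarrow> dom_le t m g"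
  shows "coord (emb t P) h \<noteq> 0 \<Longrightarrow> dom_le t h g" and "coord (emb t P) g = Poly_Mapping.lookup P g"
proof -
  let ?b = "coords (emb t P)"
  obtain Q where Q: "\<And>h. emb t (Q h) = Lg h" "\<And>h. Poly_Mapping.lookup (Q h) h = 1"
    "\<And>h m. m \<in> Poly_Mapping.keys (Q h) \<Longrightarrow> dom_le t m h"
    using pointed_Lg unfolding pointed_iff by metis
  have "emb t P = emb t (\<Sum>h\<in>Poly_Mapping.keys ?b. Poly_Mapping.single 0 (Poly_Mapping.lookup ?b h) * Q h)"
    by (subst expansion[OF assms(1)]) (simp add: emb_rules Q)
  then have P: "P = (\<Sum>h\<in>Poly_Mapping.keys ?b. Poly_Mapping.single 0 (Poly_Mapping.lookup ?b h) * Q h)"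
    by (simp add: emb_eq_iff)
  have lookP: "Poly_Mapping.lookup P m = (\<Sum>h\<in>Poly_Mapping.keys ?b. Poly_Mapping.lookup ?b h * Poly_Mapping.lookup (Q h) m)" for m
    by (subst P) (simp add: lookup_sum)
  have max: "Poly_Mapping.lookup P m = Poly_Mapping.lookup ?b m"
    if "\<And>h. h \<in> Poly_Mapping.keys ?b \<Longrightarrow> \<not> dom_less t m h" for m
  proof -
    have "Poly_Mapping.lookup (Q h) m = 0" if "h \<in> Poly_Mapping.keys ?b" "h \<noteq> m" for h
      using that Q(3)[of m h] \<open>h \<in> _ \<Longrightarrow> \<not> dom_less t m h\<close> by (auto simp: dom_less_def in_keys_iff)
    then have "Poly_Mapping.lookup P m = (\<Sum>h\<in>Poly_Mapping.keys ?b. if h = m then Poly_Mapping.lookup ?b m else 0)"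
      unfolding lookP by (intro sum.cong refl) (auto simp: Q)
    then show ?thesis by (simp add: in_keys_iff)
  qed
  have le': "dom_le t h g" if h: "h \<in> Poly_Mapping.keys ?b" for h
  proof -
    obtain m where m: "m \<in> Poly_Mapping.keys ?b" "dom_le t h m"
      "\<And>m'. m' \<in> Poly_Mapping.keys ?b \<Longrightarrow> \<not> dom_less t m m'"
      using ex_maximal_above[OF finite_keys h] by blast
    have "m \<in> Poly_Mapping.keys P"
      using max[OF m(3)] m(1) by (simp add: in_keys_iff)
    then show ?thesis using le m(2) dom_le_trans by blast
  qed
  then show "coord (emb t P) h \<noteq> 0 \<Longrightarrow> dom_le t h g" by (simp add: in_keys_iff)
  have "\<not> dom_less t g h" if "h \<in> Poly_Mapping.keys ?b" for h
    using le'[OF that] dom_le_antisym by (auto simp: dom_less_def)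
  then show "coord (emb t P) g = Poly_Mapping.lookup P g"
    using max by simp
qed

text \<open>\<open>lead Z w g\<close> means \<open>Z \<in> v\<^sup>w (L\<^sub>g + \<Sum> \<^bold>m L\<^sub>h)\<close>, the sum being over \<open>h \<prec> g\<close>.\<close>

definition lead :: "'k \<Rightarrow> int \<Rightarrow> int ^ 'i \<Rightarrow> bool" where
  "lead Z w g \<longleftrightarrow> Z \<in> A \<and> coord Z g = vpow w \<and>
     (\<forall>h. h \<noteq> g \<longrightarrow> coord Z h \<noteq> 0 \<longrightarrow> dom_less t h g \<and> coord Z h \<in> zv_le (w - 1))"

lemma lead_zv_le: "lead Z w g \<Longrightarrow> coord Z h \<in> zv_le w"
  unfolding lead_def by (cases "h = g"; cases "coord Z h = 0") (auto intro: zv_le_mono)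

lemma lead_dom_le: "lead Z w g \<Longrightarrow> coord Z h \<noteq> 0 \<Longrightarrow> dom_le t h g"
  unfolding lead_def by (cases "h = g") (auto simp: dom_less_def)

lemma lead_Lg: "lead (Lg g) 0 g"
  by (simp add: lead_def L_subset_A coords_Lg lookup_single when_def)

lemma lead_scale:
  assumes "lead Z w g"
  shows "lead (vq t powi n * Z) (n + w) g"
proof -
  have "vq t powi n * Z = coef t (vpow n) * Z" by simp
  moreover have "lead (coef t (vpow n) * Z) (n + w) g"
    using assms zv_le_mult[of "vpow n" n _ "w - 1"]
    by (auto simp: lead_def A_scale coords_scale vpow_mult simp del: coef_vpow) (metis add_diff_eq mult_zero_right order_refl zv_le_vpow)
  ultimately show ?thesis by simp
qed

text \<open>Replaces each \<open>Lg h\<close> in the expansion of \<open>Z\<close> by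
  \<open>F h\<close>. For \<open>h \<prec> g\<close> the leading coefficient of \<open>F h\<close>
  may be as large as \<open>v^(u h)\<close>; the required drop by one comes from
  \<open>coord Z h\<close>, and \<open>u h \<le> u g\<close> keeps it.\<close>

lemma lead_combine:
  assumes Z: "lead Z w g"
    and F: "\<And>h. dom_le t h g \<Longrightarrow> lead (F h) (u h) (h + m)"
    and u: "\<And>h. dom_le t h g \<Longrightarrow> u h \<le> u g"
  shows "lead (\<Sum>h\<in>Poly_Mapping.keys (coords Z). coef t (coord Z h) * F h) (w + u g) (g + m)"
proof -
  let ?Y = "\<Sum>h\<in>Poly_Mapping.keys (coords Z). coef t (coord Z h) * F h"
  have le: "dom_le t h g" if "h \<in> Poly_Mapping.keys (coords Z)" for h
    using lead_dom_le[OF Z] that by (simp add: in_keys_iff)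
  have FA: "F h \<in> A" if "h \<in> Poly_Mapping.keys (coords Z)" for h
    using F[OF le[OF that]] by (simp add: lead_def)
  have cfY: "coord ?Y k = (\<Sum>h\<in>Poly_Mapping.keys (coords Z). coord Z h * coord (F h) k)" for k
    by (rule coord_combination(2)) (rule FA)
  have YA: "?Y \<in> A"
    by (rule coord_combination(1)) (rule FA)
  have gZ: "g \<in> Poly_Mapping.keys (coords Z)" and Zg: "coord Z g = vpow w"
    using Z by (auto simp: lead_def in_keys_iff)
  have Fg: "coord (F g) (g + m) = vpow (u g)"
    using F[OF dom_le_refl] by (simp add: lead_def)
  have "coord ?Y (g + m) = (\<Sum>h\<in>Poly_Mapping.keys (coords Z). if h = g then vpow (w + u g) else 0)"
    unfolding cfY
  proof (intro sum.cong refl)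
    fix h assume h: "h \<in> Poly_Mapping.keys (coords Z)"
    show "coord Z h * coord (F h) (g + m) = (if h = g then vpow (w + u g) else 0)"
    proof (cases "h = g")
      case False
      have "coord (F h) (g + m) = 0"
        using lead_dom_le[OF F[OF le[OF h]], of "g + m"] le[OF h] False dom_le_antisym
        by auto
      with False show ?thesis by simp
    qed (simp add: Zg Fg vpow_mult)
  qed
  then have top: "coord ?Y (g + m) = vpow (w + u g)"
    using gZ by simp
  have "dom_less t k (g + m) \<and> coord ?Y k \<in> zv_le (w + u g - 1)" if k: "k \<noteq> g + m" "coord ?Y k \<noteq> 0" for k
  proof
    obtain h where h: "h \<in> Poly_Mapping.keys (coords Z)" "coord Z h * coord (F h) k \<noteq> 0"
      using k(2) unfolding cfY by (meson sum.neutral)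
    then have "dom_le t k (h + m)"
      using lead_dom_le[OF F[OF le[OF h(1)]], of k] by auto
    moreover have "dom_le t (h + m) (g + m)" using le[OF h(1)] by simp
    ultimately show "dom_less t k (g + m)"
      using k(1) dom_le_trans unfolding dom_less_def by blast
    show "coord ?Y k \<in> zv_le (w + u g - 1)"
      unfolding cfY
    proof (rule zv_le_sum)
      fix h assume h: "h \<in> Poly_Mapping.keys (coords Z)"
      show "coord Z h * coord (F h) k \<in> zv_le (w + u g - 1)"
      proof (cases "h = g")
        case True
        have "coord (F g) k \<in> zv_le (u g - 1)"
          using F[OF dom_le_refl] k(1) unfolding lead_def by (metis zv_le_0)
        then show ?thesis
          using zv_le_mult[of "vpow w" w "coord (F g) k" "u g - 1"] True Zg by (simp add: add_diff_eq)
      next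
        case False
        have "coord Z h \<in> zv_le (w - 1)"
          using Z False unfolding lead_def by (metis zv_le_0)
        moreover have "coord (F h) k \<in> zv_le (u h)"
          by (rule lead_zv_le[OF F[OF le[OF h]]])
        ultimately have "coord Z h * coord (F h) k \<in> zv_le (w - 1 + u h)"
          by (rule zv_le_mult)
        then show ?thesis
          using u[OF le[OF h]] by (elim zv_le_mono) simp
      qed
    qed
  qed
  then show ?thesis
    unfolding lead_def using top YA by blast
qed

text \<open>The triangularity axiom without normalization: \<open>Lg g\<close> is pointed, so the
  leading coefficient that \<open>normalized\<close> divides out is a pure power of \<open>v\<close>
  with exponent given by the form.\<close>

lemma lead_tmon_axis: "lead (tmon t (axis i 1) * Lg g) (lam_form (lam t) (axis i 1) g) (g + axis i 1)"
proof -
  let ?w = "lam_form (lam t) (axis i 1) g" and ?Z = "tmon t (axis i 1) * Lg g"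
  obtain P where P: "emb t P = vq t powi (- ?w) * ?Z" "lp_has_degree t P (axis i 1 + g)"
    "Poly_Mapping.lookup P (axis i 1 + g) = 1"
    using pointed_mult[OF pointed_tmon pointed_Lg] unfolding pointed_def by blast
  let ?P = "Poly_Mapping.single 0 (vpow ?w) * P"
  have inv: "vq t powi ?w * (vq t powi (- ?w) * x) = x" "vq t powi (- ?w) * (vq t powi ?w * x) = x" for x
    by (simp_all flip: mult.assoc powi_add)
  have embP: "emb t ?P = ?Z"
    by (simp add: emb_scale P inv)
  have deg: "lp_has_degree t ?P (axis i 1 + g)"
  proof -
    have "Poly_Mapping.keys ?P \<subseteq> Poly_Mapping.keys P" by (auto simp: in_keys_iff)
    moreover have "axis i 1 + g \<in> Poly_Mapping.keys ?P" using P(3) by (simp add: in_keys_iff)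
    ultimately show ?thesis using P(2) unfolding lp_has_degree_iff by blast
  qed
  \<comment> \<open>The two descriptions inside \<open>normalized\<close> are well defined by
    injectivity of \<open>emb t\<close> and uniqueness of degrees.\<close>
  have 1: "(THE P. emb t P = ?Z) = ?P"
    using embP by (intro the_equality) (auto simp: emb_eq_iff simp flip: embP)
  have 2: "(THE g. lp_has_degree t ?P g) = axis i 1 + g"
    using deg lp_has_degree_unique by blast
  have "normalized t ?Z = vq t powi (- ?w) * ?Z"
    unfolding normalized_def Let_def 1 2 by (simp add: P(3) power_int_minus)
  then obtain b :: "'i lp" where b: "vq t powi (- ?w) * ?Z = expand b"
    "\<And>g'. g' \<in> Poly_Mapping.keys b \<Longrightarrow> dom_le t g' (g + axis i 1)"
    "Poly_Mapping.lookup b (g + axis i 1) = 1"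
    "\<And>g'. dom_less t g' (g + axis i 1) \<Longrightarrow> Poly_Mapping.lookup b g' \<in> zv_le (- 1)"
    using triangular_axiom[of i g] unfolding lincomb_def by auto
  have "lead (expand b) 0 (g + axis i 1)"
    using b(2-4) by (auto simp: lead_def expand_in_A in_keys_iff dom_less_def)
  then have "lead (vq t powi ?w * expand b) (?w + 0) (g + axis i 1)"
    by (rule lead_scale)
  then show ?thesis
    by (simp add: inv flip: b(1))
qed

lemma tmon_mult_expansion:
  assumes "Z \<in> A"
  shows "x * Z = (\<Sum>h\<in>Poly_Mapping.keys (coords Z). coef t (coord Z h) * (x * Lg h))"
proof -
  have "x * (coef t p * y) = coef t p * (x * y)" for p y
    by (metis coef_central mult.assoc)
  then show ?thesis
    by (subst expansion[OF assms]) (simp add: sum_distrib_left)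
qed

definition left_triangular :: "int ^ 'i \<Rightarrow> bool" where
  "left_triangular m \<longleftrightarrow> (\<forall>k\<in>uf t. 0 \<le> m $ k) \<and> (\<forall>g. lead (tmon t m * Lg g) (lam_form (lam t) m g) (g + m))"

lemma left_triangular_0: "left_triangular 0"
  by (simp add: left_triangular_def tmon_0 lead_Lg)

text \<open>Apply \<open>tmon t m\<close> to the expansion of \<open>tmon t m' * Lg g\<close>.
  Nonnegativity of \<open>m\<close> on \<open>uf t\<close>, which is part of
  \<open>left_triangular\<close> for this purpose, gives the monotone exponents required by
  \<open>lead_combine\<close>.\<close>

lemma left_triangular_add:
  assumes "left_triangular m" "left_triangular m'"
  shows "left_triangular (m + m')"
proof -
  have "lead (tmon t (m + m') * Lg g) (lam_form (lam t) (m + m') g) (g + (m + m'))" for g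
  proof -
    let ?Z = "tmon t m' * Lg g"
    have Z: "lead ?Z (lam_form (lam t) m' g) (g + m')" using assms(2) by (simp add: left_triangular_def)
    have "lead (\<Sum>h\<in>Poly_Mapping.keys (coords ?Z). coef t (coord ?Z h) * (tmon t m * Lg h))
      (lam_form (lam t) m' g + lam_form (lam t) m (g + m')) (g + m' + m)"
      using assms(1) by (intro lead_combine[OF Z, where u = "lam_form (lam t) m"] dom_le_lam_form_ge)
        (auto simp: left_triangular_def)
    then have "lead (tmon t m * ?Z) (lam_form (lam t) m' g + lam_form (lam t) m (g + m')) (g + m' + m)"
      using Z by (subst tmon_mult_expansion) (simp_all add: lead_def[of ?Z])
    then have "lead (vq t powi (- lam_form (lam t) m m') * (tmon t m * ?Z))
        (- lam_form (lam t) m m' + (lam_form (lam t) m' g + lam_form (lam t) m (g + m'))) (g + m' + m)"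
      by (rule lead_scale)
    moreover have "vq t powi (- lam_form (lam t) m m') * (tmon t m * ?Z) = tmon t (m + m') * Lg g"
    proof -
      have "vq t powi (- lam_form (lam t) m m') * (tmon t m * tmon t m') = tmon t (m + m')"
        by (simp add: tmon_mult flip: mult.assoc powi_add)
      then show ?thesis by (metis mult.assoc)
    qed
    ultimately show ?thesis
      by (simp add: lam_form_add_left lam_form_add_right algebra_simps)
  qed
  then show ?thesis using assms by (simp add: left_triangular_def)
qed

lemma L_bar:
  assumes "Z \<in> L"
  obtains P where "emb t P = Z" "bar P = P"
  using bar_invariant_L[OF assms] unfolding bar_invariant_def by blast

text \<open>Bar fixes the elements of \<open>L\<close> and reverses products, so applied to the
  expansion of \<open>y * x\<close> it yields the one of \<open>x * y\<close>. Through it a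
  statement on right multiplication becomes one on left multiplication.\<close>

lemma coord_bar:
  assumes "x \<in> L" "y \<in> L"
  shows "coord (x * y) h = zv_bar (coord (y * x) h)"
proof -
  obtain P where P: "emb t P = x" "bar P = P" using L_bar[OF assms(1)] by blast
  obtain Q where Q: "emb t Q = y" "bar Q = Q" using L_bar[OF assms(2)] by blast
  obtain R where R: "\<And>h. emb t (R h) = Lg h" "\<And>h. bar (R h) = R h"
  proof -
    have "\<forall>h. \<exists>P. emb t P = Lg h \<and> bar P = P" using L_bar[OF Lg_in_L] by blast
    then show thesis using that by metis
  qed
  let ?b = "coords (y * x)"
  have A: "y * x \<in> A" using assms by (simp add: A_mult L_subset_A)
  have "emb t (twisted_mult (lam t) Q P) =
      emb t (\<Sum>h\<in>Poly_Mapping.keys ?b. Poly_Mapping.single 0 (Poly_Mapping.lookup ?b h) * R h)"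
    by (simp add: emb_twisted_mult emb_rules P Q R flip: expansion[OF A])
  then have "twisted_mult (lam t) Q P =
      (\<Sum>h\<in>Poly_Mapping.keys ?b. Poly_Mapping.single 0 (Poly_Mapping.lookup ?b h) * R h)"
    by (simp add: emb_eq_iff)
  then have "bar (twisted_mult (lam t) Q P) =
      (\<Sum>h\<in>Poly_Mapping.keys ?b. Poly_Mapping.single 0 (zv_bar (Poly_Mapping.lookup ?b h)) * R h)"
    by (simp add: bar_sum bar_scale R)
  then have "twisted_mult (lam t) P Q =
      (\<Sum>h\<in>Poly_Mapping.keys ?b. Poly_Mapping.single 0 (zv_bar (Poly_Mapping.lookup ?b h)) * R h)"
    using bar_twisted_mult[of "lam t" Q P, OF lam_skew] by (simp add: P Q)
  then have "x * y = (\<Sum>h\<in>Poly_Mapping.keys (bar ?b). coef t (Poly_Mapping.lookup (bar ?b) h) * Lg h)"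
    unfolding P(1)[symmetric] Q(1)[symmetric] emb_twisted_mult[symmetric]
    by (simp add: emb_rules R keys_bar lookup_bar)
  then have "x * y = expand (bar ?b)" by (simp add: lincomb_def)
  then show ?thesis by (simp add: lookup_bar)
qed

lemma tmon_frozen_axis:
  assumes i: "i \<notin> uf t"
  shows "tmon t (axis i 1) * Lg g = vq t powi lam_form (lam t) (axis i 1) g * Lg (g + axis i 1)"
proof -
  let ?f = "axis i 1 :: int ^ 'i" and ?w = "lam_form (lam t) (axis i 1) g"
  have lead: "lead (tmon t ?f * Lg g) ?w (g + ?f)" by (rule lead_tmon_axis)
  obtain P where P: "emb t P = Lg g" "\<And>m. m \<in> Poly_Mapping.keys P \<Longrightarrow> dom_le t m g"
    using pointed_Lg unfolding pointed_iff by metis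
  have comm: "Lg g * tmon t ?f = coef t (vpow (- 2 * ?w)) * (tmon t ?f * Lg g)"
  proof -
    have c: "a * (b * z) = b * (a * z)" if "b = coef t q" for a b z q
      unfolding that by (metis coef_central mult.assoc)
    have "coef t (Poly_Mapping.lookup P m) * tmon t m * tmon t ?f =
        coef t (vpow (- 2 * ?w)) * (tmon t ?f * (coef t (Poly_Mapping.lookup P m) * tmon t m))"
      if m: "m \<in> Poly_Mapping.keys P" for m
    proof -
      have "lam_form (lam t) ?f m = ?w"
        using i by (intro dom_le_lam_form_eq P m) (auto simp: axis_nth)
      then have fm: "tmon t ?f * tmon t m = vq t powi ?w * tmon t (m + ?f)"
        "tmon t m * tmon t ?f = vq t powi (- ?w) * tmon t (m + ?f)"
        using tmon_mult[of ?f m] tmon_mult[of m ?f] by (simp_all add: lam_form_skew[of m ?f] add.commute)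
      have "coef t (vpow (- 2 * ?w)) * (tmon t ?f * (coef t (Poly_Mapping.lookup P m) * tmon t m)) =
          coef t (Poly_Mapping.lookup P m) * (vq t powi (- 2 * ?w) * (tmon t ?f * tmon t m))"
        by (simp add: c[OF refl, of "tmon t ?f"] c[OF refl, of "vq t powi _"])
      also have "vq t powi (- 2 * ?w) * (tmon t ?f * tmon t m) = tmon t m * tmon t ?f"
        unfolding fm by (simp flip: mult.assoc powi_add)
      finally show ?thesis by (simp add: mult.assoc)
    qed
    then show ?thesis
      by (simp add: P(1)[symmetric] emb_def sum_distrib_left sum_distrib_right)
  qed
  \<comment> \<open>Swapping the factors shows \<open>c = v^(2w) * bar c\<close> for the coordinate
    \<open>c\<close>. The bound \<open>c \<in> v^(w-1) \<int>[v^-1]\<close> then gives also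
    \<open>c \<in> v^(w+1) \<int>[v]\<close>, so \<open>c\<close> vanishes.\<close>
  have "coord (tmon t ?f * Lg g) h = 0" if "h \<noteq> g + ?f" for h
  proof -
    let ?c = "coord (tmon t ?f * Lg g) h"
    have c: "?c \<in> zv_le (?w - 1)"
      using lead that unfolding lead_def by (metis zv_le_0)
    have "?c = zv_bar (coord (Lg g * tmon t ?f) h)"
      by (rule coord_bar) (simp_all add: tmon_axis_L)
    also have "\<dots> = vpow (2 * ?w) * zv_bar ?c"
      using lead by (subst comm, subst coords_scale) (simp_all add: lead_def zv_bar_mult)
    also have "\<dots> \<in> zv_ge (2 * ?w + - (?w - 1))"
      by (intro zv_ge_mult zv_bar_le c) simp
    finally show ?thesis
      using c by (intro zv_le_ge_eq_0) auto
  qed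
  then have "coords (tmon t ?f * Lg g) = Poly_Mapping.single (g + ?f) (vpow ?w)"
    using lead by (intro poly_mapping_eqI) (auto simp: lookup_single when_def lead_def)
  then have "expand (coords (tmon t ?f * Lg g)) = vq t powi ?w * Lg (g + ?f)"
    by (simp add: expand_rules)
  then show ?thesis
    using lead expand_coords by (simp add: lead_def)
qed

definition shifting :: "int ^ 'i \<Rightarrow> bool" where
  "shifting m \<longleftrightarrow> (\<forall>g. tmon t m * Lg g = vq t powi lam_form (lam t) m g * Lg (g + m))"

lemma shifting_0: "shifting 0"
  by (simp add: shifting_def tmon_0)

lemma shifting_add:
  assumes "shifting m" "shifting m'"
  shows "shifting (m + m')"
  unfolding shifting_def
proof
  fix g
  have "vq t powi lam_form (lam t) m m' * (tmon t (m + m') * Lg g) = tmon t m * (tmon t m' * Lg g)"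
    by (simp add: tmon_mult flip: mult.assoc)
  also have "\<dots> = vq t powi lam_form (lam t) m' g * (tmon t m * Lg (g + m'))"
    using assms(2) unfolding shifting_def by (metis powi_central mult.assoc)
  also have "\<dots> = vq t powi (lam_form (lam t) m' g + lam_form (lam t) m (g + m')) * Lg (g + m' + m)"
    using assms(1) by (simp add: shifting_def powi_add mult.assoc)
  finally have "vq t powi (- lam_form (lam t) m m') * (vq t powi lam_form (lam t) m m' * (tmon t (m + m') * Lg g)) =
     vq t powi (- lam_form (lam t) m m') * (vq t powi (lam_form (lam t) m' g + lam_form (lam t) m (g + m')) * Lg (g + m' + m))"
    by simp
  then show "tmon t (m + m') * Lg g = vq t powi lam_form (lam t) (m + m') g * Lg (g + (m + m'))"
    by (simp add: lam_form_add_left lam_form_add_right algebra_simps flip: mult.assoc powi_add)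
qed

text \<open>\<open>tmon t (- m)\<close> inverts \<open>tmon t m\<close>, and by surjectivity of the
  shift every \<open>Lg g\<close> is, up to a power of \<open>v\<close>, the product
  \<open>tmon t m * Lg (g - m)\<close>.\<close>

lemma shifting_minus:
  assumes "shifting m"
  shows "shifting (- m)"
  unfolding shifting_def
proof
  fix g
  have "tmon t (- m) * (tmon t m * Lg (g - m)) = Lg (g - m)"
    using tmon_mult[of "- m" m] by (simp add: lam_form_minus_left tmon_0 flip: mult.assoc)
  moreover have "tmon t m * Lg (g - m) = vq t powi lam_form (lam t) m g * Lg g"
    using assms by (simp add: shifting_def lam_form_diff_right)
  ultimately have "Lg (g - m) = vq t powi lam_form (lam t) m g * (tmon t (- m) * Lg g)"
    by (metis powi_central mult.assoc)
  then show "tmon t (- m) * Lg g = vq t powi lam_form (lam t) (- m) g * Lg (g + - m)"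
    by (simp add: lam_form_minus_left flip: mult.assoc powi_add)
qed

lemma shifting_frozen:
  assumes "\<And>k. k \<in> uf t \<Longrightarrow> m $ k = 0"
  shows "shifting m"
proof (rule int_vec_sum_induct)
  fix i
  show "shifting (m $ i *s axis i 1)"
  proof (cases "i \<in> uf t")
    case False
    then have ax: "shifting (axis i 1)"
      by (simp add: shifting_def tmon_frozen_axis)
    have nat: "shifting (int n *s axis i 1)" for n
      by (induction n) (simp_all add: shifting_0 vector_sadd_rdistrib shifting_add ax)
    show ?thesis
    proof (cases "m $ i \<ge> 0")
      case True
      then show ?thesis using nat[of "nat (m $ i)"] by simp
    next
      case False
      then have "m $ i *s axis i 1 = - (int (nat (- (m $ i))) *s axis i 1)"
        by (simp add: vec_eq_iff)
      then show ?thesis using shifting_minus[OF nat] by metis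
    qed
  qed (simp add: assms shifting_0)
qed (simp_all add: shifting_0 shifting_add)

text \<open>Frozen entries of either sign are allowed, since frozen directions only shift the basis;
  unfrozen ones are built up from unit vectors.\<close>

lemma left_triangularI:
  assumes "\<And>k. k \<in> uf t \<Longrightarrow> 0 \<le> m $ k"
  shows "left_triangular m"
proof (rule int_vec_sum_induct)
  fix i
  show "left_triangular (m $ i *s axis i 1)"
  proof (cases "i \<in> uf t")
    case True
    have ax: "left_triangular (axis i 1)"
      by (simp add: left_triangular_def lead_tmon_axis axis_nth)
    have "left_triangular (int n *s axis i 1)" for n
      by (induction n) (simp_all add: left_triangular_0 vector_sadd_rdistrib left_triangular_add ax)
    from this[of "nat (m $ i)"] show ?thesis using assms[OF True] by simp
  next
    case False
    then have "shifting (m $ i *s axis i 1)"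
      by (intro shifting_frozen) (auto simp: axis_nth)
    then show ?thesis
      using False lead_scale[OF lead_Lg] by (auto simp: left_triangular_def shifting_def axis_nth)
  qed
qed (simp_all add: left_triangular_0 left_triangular_add)

lemma lead_tmon:
  assumes "\<And>k. k \<in> uf t \<Longrightarrow> 0 \<le> m $ k"
  shows "lead (tmon t m * Lg g) (lam_form (lam t) m g) (g + m)"
  using left_triangularI[of m] assms by (simp add: left_triangular_def)

text \<open>Comparison of leading terms. Applied to monomials of another seed that lie in
  \<open>L\<close>, it says that their degrees add and that the two seeds' forms agree on
  them.\<close>

lemma Lg_mult_Lg:
  assumes "Lg g * Lg g' = vq t powi l * Lg g''"
  shows "g'' = g + g' \<and> l = lam_form (lam t) g g'"
proof -
  have "pointed t (g + g') (vq t powi (- lam_form (lam t) g g') * (Lg g * Lg g'))"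
    by (intro pointed_mult pointed_Lg)
  then have "pointed t (g + g') (vq t powi (l - lam_form (lam t) g g') * Lg g'')"
    by (simp add: assms algebra_simps flip: mult.assoc powi_add)
  from pointed_scaled[OF pointed_Lg this] show ?thesis by simp
qed

text \<open>\<open>I\<close> stands for the cluster monomials of a second seed, with form
  \<open>la\<close>, and \<open>dg\<close> for their degrees in the present one. \<open>neg\<close>
  supplies the monotonicity of the form under right multiplication; \<open>gen\<close> says that
  every degree \<open>g\<close> becomes nonnegative on \<open>uf t\<close> after subtracting some
  \<open>dg n\<close>.\<close>

lemma lead_right_mult:
  fixes I :: "int ^ 'i \<Rightarrow> 'k" and dg :: "int ^ 'i \<Rightarrow> int ^ 'i" and la :: "int ^ 'i \<Rightarrow> int ^ 'i \<Rightarrow> int"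
  assumes I: "\<And>m. \<forall>i. 0 \<le> m $ i \<Longrightarrow> I m = Lg (dg m)"
    and mult: "\<And>m m'. \<forall>i. 0 \<le> m $ i \<Longrightarrow> \<forall>i. 0 \<le> m' $ i \<Longrightarrow> I m * I m' = vq t powi la m m' * I (m + m')"
    and neg: "\<And>m k. \<forall>i. 0 \<le> m $ i \<Longrightarrow> k \<in> uf t \<Longrightarrow> dg m $ k \<le> 0"
    and gen: "\<And>g. \<exists>m. (\<forall>i. 0 \<le> m $ i) \<and> (\<forall>k\<in>uf t. dg m $ k \<le> g $ k)"
    and m: "\<forall>i. 0 \<le> m $ i"
  shows "lead (Lg g * I m) (lam_form (lam t) g (dg m)) (g + dg m)"
proof -
  let ?D = "dg m"
  have dg: "dg (n + n') = dg n + dg n' \<and> la n n' = lam_form (lam t) (dg n) (dg n')"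
    if n: "\<forall>i. 0 \<le> n $ i" "\<forall>i. 0 \<le> n' $ i" for n n'
  proof (rule Lg_mult_Lg)
    have "\<forall>i. 0 \<le> (n + n') $ i" using n by simp
    then show "Lg (dg n) * Lg (dg n') = vq t powi la n n' * Lg (dg (n + n'))"
      using mult[OF n] by (simp add: I n)
  qed
  note dg_add = dg[THEN conjunct1] and la = dg[THEN conjunct2]
  have A: "Lg g * I m \<in> A" for g
    by (simp add: A_mult L_subset_A I[OF m])
  \<comment> \<open>Support and leading coefficient follow from pointedness alone; only the bound on
    the powers of \<open>v\<close> needs the induction below.\<close>
  have support: "coord (Lg g * I m) h \<noteq> 0 \<Longrightarrow> dom_le t h (g + ?D)"
    and top: "coord (Lg g * I m) (g + ?D) = vpow (lam_form (lam t) g ?D)" for g h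
  proof -
    let ?w = "lam_form (lam t) g ?D"
    obtain P where P: "emb t P = vq t powi (- ?w) * (Lg g * I m)" "Poly_Mapping.lookup P (g + ?D) = 1"
      "\<And>m. m \<in> Poly_Mapping.keys P \<Longrightarrow> dom_le t m (g + ?D)"
      using pointed_mult[OF pointed_Lg[of g] pointed_Lg[of ?D]] unfolding pointed_iff I[OF m] by blast
    let ?P = "Poly_Mapping.single 0 (vpow ?w) * P"
    have e: "emb t ?P = Lg g * I m"
      by (simp add: emb_scale P(1) flip: mult.assoc powi_add)
    have k: "dom_le t m (g + ?D)" if "m \<in> Poly_Mapping.keys ?P" for m
      using that by (intro P(3)) (auto simp: in_keys_iff)
    show "coord (Lg g * I m) h \<noteq> 0 \<Longrightarrow> dom_le t h (g + ?D)"
      using expansion_support(1)[of ?P "g + ?D" h] A[of g] k unfolding e by blast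
    show "coord (Lg g * I m) (g + ?D) = vpow ?w"
      using expansion_support(2)[of ?P "g + ?D"] A[of g] k unfolding e by (simp add: P(2))
  qed
  \<comment> \<open>Induction on \<open>g\<close> for a fixed target degree \<open>k\<close>. Going
    down from \<open>g\<close> to \<open>h\<close> raises the height of \<open>h + ?D\<close>, while
    a nonzero coordinate at \<open>k \<noteq> h + ?D\<close> forces \<open>k\<close> to lie strictly
    below, so the measure decreases.\<close>
  have "coord (Lg g * I m) k \<in> zv_le (lam_form (lam t) g ?D - 1)" if "k \<noteq> g + ?D" for g k
    using that
  proof (induction "nat (height k - height (g + ?D))" arbitrary: g rule: less_induct)
    case less
    obtain n where n: "\<forall>i. 0 \<le> n $ i" "\<forall>k\<in>uf t. dg n $ k \<le> g $ k"
      using gen by blast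
    define a where "a = g - dg n"
    have a: "0 \<le> a $ k" if "k \<in> uf t" for k using n that by (simp add: a_def)
    let ?w = "lam_form (lam t) a (dg n)" and ?Y = "tmon t a * I n"
    have Y: "lead ?Y ?w g"
      using lead_tmon[of a "dg n", OF a] by (simp add: I n a_def)
    have nm: "\<forall>i. 0 \<le> (n + m) $ i" using n m by simp
    \<comment> \<open>Both forms agree on degrees, so \<open>la n m\<close> cancels the pairing of
      \<open>dg n\<close> with \<open>?D\<close> that comes from
      \<open>a = g - dg n\<close>.\<close>
    have w: "la n m + lam_form (lam t) a (dg n + ?D) = ?w + lam_form (lam t) g ?D"
      using la[OF n(1) m] by (simp add: a_def lam_form_add_right lam_form_diff_left)
    have "lead (tmon t a * I (n + m)) (lam_form (lam t) a (dg n + ?D)) (dg n + ?D + a)"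
      unfolding I[OF nm] dg_add[OF n(1) m] by (rule lead_tmon) (rule a)
    then have "lead (vq t powi la n m * (tmon t a * I (n + m))) (?w + lam_form (lam t) g ?D) (dg n + ?D + a)"
      unfolding w[symmetric] by (rule lead_scale)
    moreover have "vq t powi la n m * (tmon t a * I (n + m)) = ?Y * I m"
      using mult[OF n(1) m] by (metis powi_central mult.assoc)
    moreover have "dg n + ?D + a = g + ?D" by (simp add: a_def)
    ultimately have YI: "lead (?Y * I m) (?w + lam_form (lam t) g ?D) (g + ?D)"
      by simp
    have YA: "?Y \<in> A" using Y by (simp add: lead_def)
    have "?Y * I m = (\<Sum>h\<in>Poly_Mapping.keys (coords ?Y). coef t (coord ?Y h) * (Lg h * I m))"
      by (subst expansion[OF YA]) (simp add: sum_distrib_right mult.assoc)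
    then have "coord (?Y * I m) k = (\<Sum>h\<in>Poly_Mapping.keys (coords ?Y). coord ?Y h * coord (Lg h * I m) k)"
      using coord_combination(2)[of "coords ?Y" "\<lambda>h. Lg h * I m" k] A by simp
    also have "\<dots> = coord ?Y g * coord (Lg g * I m) k +
        (\<Sum>h\<in>Poly_Mapping.keys (coords ?Y) - {g}. coord ?Y h * coord (Lg h * I m) k)"
      using Y by (intro sum.remove) (auto simp: lead_def in_keys_iff)
    \<comment> \<open>The \<open>g\<close>-term has the unit \<open>vpow ?w\<close> as coefficient,
      so the unknown coordinate can be solved for.\<close>
    finally have eq: "vpow ?w * coord (Lg g * I m) k = coord (?Y * I m) k -
        (\<Sum>h\<in>Poly_Mapping.keys (coords ?Y) - {g}. coord ?Y h * coord (Lg h * I m) k)"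
      using Y by (simp add: lead_def)
    have "coord ?Y h * coord (Lg h * I m) k \<in> zv_le (?w + lam_form (lam t) g ?D - 1)"
      if h: "h \<in> Poly_Mapping.keys (coords ?Y) - {g}" for h
    proof (cases "coord (Lg h * I m) k = 0")
      case False
      have hg: "dom_less t h g" "coord ?Y h \<in> zv_le (?w - 1)"
        using Y h by (auto simp: lead_def in_keys_iff)
      \<comment> \<open>The bound is weaker by one than the induction hypothesis, since
        \<open>k\<close> may be the leading degree \<open>h + ?D\<close>; the missing drop is
        provided by \<open>coord ?Y h\<close>.\<close>
      have "coord (Lg h * I m) k \<in> zv_le (lam_form (lam t) h ?D)"
      proof (cases "k = h + ?D")
        case True
        then show ?thesis by (simp add: top)
      next
        case neq: False
        have "dom_less t k (h + ?D)" using support[OF False] neq by (simp add: dom_less_def)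
        moreover have "height (g + ?D) < height (h + ?D)"
          using hg(1) by (intro dom_less_height) simp
        ultimately have "nat (height k - height (h + ?D)) < nat (height k - height (g + ?D))"
          using dom_less_height[of k "h + ?D"] by simp
        from less.hyps[OF this neq] show ?thesis by (elim zv_le_mono) simp
      qed
      moreover have "lam_form (lam t) h ?D \<le> lam_form (lam t) g ?D"
        using hg(1) neg[OF m] by (intro dom_le_lam_form_le dom_less_imp_le)
      ultimately have "coord (Lg h * I m) k \<in> zv_le (lam_form (lam t) g ?D)"
        by (rule zv_le_mono)
      from zv_le_mult[OF hg(2) this] show ?thesis
        by (elim zv_le_mono) simp
    qed simp
    moreover have "coord (?Y * I m) k \<in> zv_le (?w + lam_form (lam t) g ?D - 1)"
      using YI less.prems unfolding lead_def by (metis zv_le_0)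
    ultimately have "vpow ?w * coord (Lg g * I m) k \<in> zv_le (?w + lam_form (lam t) g ?D - 1)"
      unfolding eq by (intro zv_le_diff zv_le_sum)
    then have "vpow (- ?w) * (vpow ?w * coord (Lg g * I m) k) \<in> zv_le (- ?w + (?w + lam_form (lam t) g ?D - 1))"
      by (intro zv_le_mult) simp
    then show ?case by (simp add: vpow_mult flip: mult.assoc)
  qed
  then show ?thesis
    unfolding lead_def using A top support by (simp add: dom_less_def)
qed

end

subsection \<open>Tropical transformations and the seed \<open>t[-1]\<close>\<close>

text \<open>Tropical transformations see only exchange matrices, on which mutation is literally an
  involution. Reversed and relabelled sequences can thus be followed without undoing mutations of
  whole seeds.\<close>

fun mut_bmat_seq :: "'i list \<Rightarrow> int ^ 'i::finite ^ 'i \<Rightarrow> int ^ 'i ^ 'i" where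
  "mut_bmat_seq [] B = B"
| "mut_bmat_seq (k # ks) B = mut_bmat_seq ks (mut_bmat k B)"

fun trop_bmat_seq :: "'i list \<Rightarrow> int ^ 'i::finite ^ 'i \<Rightarrow> int ^ 'i \<Rightarrow> int ^ 'i" where
  "trop_bmat_seq [] B g = g"
| "trop_bmat_seq (k # ks) B g = trop_bmat_seq ks (mut_bmat k B) (trop k B g)"

lemma bmat_mutate_seq: "bmat (mutate_seq ks t) = mut_bmat_seq ks (bmat t)"
  by (induction ks arbitrary: t) simp_all

lemma trop_seq_bmat: "trop_seq ks t g = trop_bmat_seq ks (bmat t) g"
  by (induction ks arbitrary: t g) simp_all

lemma mutate_seq_append: "mutate_seq (xs @ ys) t = mutate_seq ys (mutate_seq xs t)"
  by (induction xs arbitrary: t) simp_all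

lemma trop_seq_append: "trop_seq (xs @ ys) t g = trop_seq ys (mutate_seq xs t) (trop_seq xs t g)"
  by (induction xs arbitrary: t g) simp_all

lemma mut_bmat_seq_append: "mut_bmat_seq (xs @ ys) B = mut_bmat_seq ys (mut_bmat_seq xs B)"
  by (induction xs arbitrary: B) simp_all

lemma trop_bmat_seq_append:
  "trop_bmat_seq (xs @ ys) B g = trop_bmat_seq ys (mut_bmat_seq xs B) (trop_bmat_seq xs B g)"
  by (induction xs arbitrary: B g) simp_all

lemma mut_bmat_involutive: "mut_bmat k (mut_bmat k B) = B"
  by (simp add: mut_bmat_def vec_eq_iff)

lemma trop_inverse: "trop k (mut_bmat k B) (trop k B g) = g"
  by (auto simp: trop_def mut_bmat_def vec_eq_iff)

lemma mut_bmat_seq_rev: "mut_bmat_seq (rev ks) (mut_bmat_seq ks B) = B"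
  by (induction ks arbitrary: B) (simp_all add: mut_bmat_seq_append mut_bmat_involutive)

lemma trop_bmat_seq_rev: "trop_bmat_seq (rev ks) (mut_bmat_seq ks B) (trop_bmat_seq ks B g) = g"
  by (induction ks arbitrary: B g) (simp_all add: trop_bmat_seq_append mut_bmat_seq_rev trop_inverse)

lemma trop_bmat_seq_axis: "j \<notin> set ks \<Longrightarrow> trop_bmat_seq ks B (axis j 1) = axis j 1"
proof (induction ks arbitrary: B)
  case (Cons k ks)
  then have "trop k B (axis j 1) = axis j 1"
    by (auto simp: trop_def vec_eq_iff axis_nth)
  with Cons show ?case by simp
qed simp

lemma trop_bmat_seq_equivariant:
  assumes "inj_on \<sigma> U" "set ks \<subseteq> U"
    and "\<And>i j. i \<in> U \<Longrightarrow> j \<in> U \<Longrightarrow> B' $ \<sigma> i $ \<sigma> j = B $ i $ j"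
    and "\<And>i. i \<in> U \<Longrightarrow> g' $ \<sigma> i = g $ i"
    and "i \<in> U"
  shows "trop_bmat_seq (map \<sigma> ks) B' g' $ \<sigma> i = trop_bmat_seq ks B g $ i"
  using assms(2-4)
proof (induction ks arbitrary: B B' g g')
  case Nil
  then show ?case using assms(5) by simp
next
  case (Cons k ks)
  have k: "k \<in> U" using Cons.prems(1) by simp
  have eq: "\<sigma> i = \<sigma> j \<longleftrightarrow> i = j" if "i \<in> U" "j \<in> U" for i j
    using assms(1) that by (auto dest: inj_onD)
  have "mut_bmat (\<sigma> k) B' $ \<sigma> i $ \<sigma> j = mut_bmat k B $ i $ j" if "i \<in> U" "j \<in> U" for i j
    using k that by (simp add: mut_bmat_def Cons.prems(2) eq)
  moreover have "trop (\<sigma> k) B' g' $ \<sigma> i = trop k B g $ i" if "i \<in> U" for i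
    using k that by (simp add: trop_def Cons.prems(2,3) eq)
  ultimately show ?case
    using Cons.IH[of "mut_bmat (\<sigma> k) B'" "mut_bmat k B" "trop (\<sigma> k) B' g'" "trop k B g"] Cons.prems(1)
    by simp
qed

lemma triangular_basis_imp_triangular:
  assumes "quantum_torus t d" "zv_subalgebra t A" "triangular_basis t A L"
  obtains Lg where "triangular t d A L Lg"
proof -
  from assms(3) obtain Lg where Lg: "L = range Lg" "\<And>g. pointed t g (Lg g)"
    "\<And>g i. \<exists>b :: (int ^ 'a) \<Rightarrow>\<^sub>0 zv.
           normalized t (tmon t (axis i 1) * Lg g) =
             (\<Sum>g'\<in>Poly_Mapping.keys b. coef t (Poly_Mapping.lookup b g') * Lg g') \<and>
           (\<forall>g'\<in>Poly_Mapping.keys b. dom_le t g' (g + axis i 1)) \<and>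
           Poly_Mapping.lookup b (g + axis i 1) = 1 \<and>
           (\<forall>g'. dom_less t g' (g + axis i 1) \<longrightarrow> Poly_Mapping.lookup b g' \<in> zv_le (- 1))"
    unfolding triangular_basis_def by blast
  have "triangular t d A L Lg"
    using assms Lg by (intro triangular.intro triangular_axioms.intro) (auto simp: triangular_basis_def)
  then show thesis by (rule that)
qed

lemma triangular_basis_pointed: "triangular_basis t A L \<Longrightarrow> Z \<in> L \<Longrightarrow> \<exists>g. pointed t g Z"
  unfolding triangular_basis_def by (elim conjE exE) auto

lemma (in triangular) sum_over_L:
  assumes "Z \<in> A"
  obtains b where "finite {W. b W \<noteq> 0}" "{W. b W \<noteq> 0} \<subseteq> L" "Z = (\<Sum>W | b W \<noteq> 0. coef t (b W) * W)"
    "\<And>h. b (Lg h) = coord Z h"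
proof -
  have inj: "inj Lg" by (simp add: inj_def Lg_eq_iff)
  define b where "b W = (if W \<in> L then coord Z (inv Lg W) else 0)" for W
  have bL: "b (Lg h) = coord Z h" for h
    by (simp add: b_def inv_f_f[OF inj])
  have supp: "{W. b W \<noteq> 0} = Lg ` Poly_Mapping.keys (coords Z)"
    by (auto simp: b_def range_Lg in_keys_iff inv_f_f[OF inj] Lg_eq_iff split: if_splits)
  have "(\<Sum>W | b W \<noteq> 0. coef t (b W) * W) = (\<Sum>h\<in>Poly_Mapping.keys (coords Z). coef t (coord Z h) * Lg h)"
    unfolding supp by (simp add: sum.reindex[OF inj_on_subset[OF inj subset_UNIV]] bL)
  also have "\<dots> = Z" by (rule expansion[OF assms, symmetric])
  finally have sum: "(\<Sum>W | b W \<noteq> 0. coef t (b W) * W) = Z" .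
  show thesis
  proof (rule that)
    show "finite {W. b W \<noteq> 0}" "{W. b W \<noteq> 0} \<subseteq> L"
      unfolding supp by auto
  qed (simp_all only: sum bL)
qed

text \<open>The definition transports degrees from \<open>t\<close> only. Uniqueness of the degree
  at the intermediate seed identifies \<open>g\<close> as transported along \<open>xs\<close>, and
  \<open>xs @ ys\<close> does the rest.\<close>

lemma seed_transport:
  assumes t: "quantum_torus t d" "common_triangular_basis t A L"
    and ks: "set xs \<subseteq> uf t" "set ys \<subseteq> uf t"
    and Z: "Z \<in> L" "pointed (mutate_seq xs t) g Z"
  shows "pointed (mutate_seq ys (mutate_seq xs t)) (trop_seq ys (mutate_seq xs t) g) Z"
proof -
  obtain g0 where g0: "pointed t g0 Z"
    using t(2) triangular_basis_pointed[OF _ Z(1)] unfolding common_triangular_basis_def by blast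
  have p: "pointed (mutate_seq ks t) (trop_seq ks t g0) Z" if "set ks \<subseteq> uf t" for ks
    using t(2) Z(1) g0 that unfolding common_triangular_basis_def by blast
  interpret t': quantum_torus "mutate_seq xs t" d
    by (rule quantum_torus_mutate_seq[OF t(1) ks(1)])
  have "trop_seq xs t g0 = g"
    using t'.pointed_unique[OF p[OF ks(1)] Z(2)] .
  then show ?thesis
    using p[of "xs @ ys"] ks by (simp add: mutate_seq_append trop_seq_append)
qed

text \<open>Every seed \<open>t'\<close> of \<open>\<Delta>\<^sup>+\<close> is of the form \<open>t''[1]\<close> as far as degrees are concerned: replaying
  the sequence from \<open>t'\<close> to \<open>t'[1]\<close> backwards, relabelled by \<open>\<sigma>\<close>, from \<open>t'\<close> gives \<open>t'' = t'[-1]\<close>.\<close>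

lemma inverse_shift:
  fixes t :: "('i::finite, 'k::division_ring) qseed"
  assumes t: "quantum_torus t d" "common_triangular_basis t A L"
    and xs: "set xs \<subseteq> uf t"
  obtains ys \<sigma> where "set ys \<subseteq> uf t" "\<sigma> permutes uf t"
    "\<And>i j. i \<in> uf t \<Longrightarrow> j \<in> uf t \<Longrightarrow>
      trop_seq ys (mutate_seq xs t) (axis j 1) $ i = (if j = \<sigma> i then -1 else 0)"
    "\<And>j. j \<notin> uf t \<Longrightarrow> trop_seq ys (mutate_seq xs t) (axis j 1) = axis j 1"
proof -
  let ?t' = "mutate_seq xs t"
  have tb: "triangular_basis ?t' A L"
    using t(2) xs unfolding common_triangular_basis_def by blast
  interpret t': quantum_torus ?t' d
    by (rule quantum_torus_mutate_seq[OF t(1) xs])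
  obtain t1 where t1: "is_shift ?t' t1" "cluster_monomials_in t1 \<subseteq> L"
    using tb unfolding triangular_basis_def by blast
  obtain ks where ks: "t1 = mutate_seq ks ?t'" "set ks \<subseteq> uf t"
    using t1(1) unfolding is_shift_def Delta_plus_def by auto
  interpret t1: quantum_torus t1 d
    unfolding ks(1) using ks(2) by (intro quantum_torus_mutate_seq t'.quantum_torus_axioms) simp
  obtain \<sigma> where \<sigma>: "\<sigma> permutes uf t"
    "\<And>i j. i \<in> uf t \<Longrightarrow> j \<in> uf t \<Longrightarrow> bmat t1 $ \<sigma> i $ \<sigma> j = bmat ?t' $ i $ j"
    "\<And>k. k \<in> uf t \<Longrightarrow> \<exists>g. has_degree ?t' (tmon t1 (axis (\<sigma> k) 1)) g \<and>
           (\<forall>i\<in>uf t. g $ i = (- axis k 1 :: int ^ 'i) $ i)"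
    using t1(1) unfolding is_shift_def by auto
  have inj: "inj \<sigma>" using \<sigma>(1) by (rule permutes_inj)
  define ys where "ys = map (inv \<sigma>) (rev ks)"
  have ys: "map \<sigma> ys = rev ks"
    by (simp add: ys_def o_def permutes_inverses[OF \<sigma>(1)])
  have ys_uf: "set ys \<subseteq> uf t"
    using ks(2) permutes_in_image[OF permutes_inv[OF \<sigma>(1)]] by (auto simp: ys_def)
  have "trop_seq ys ?t' (axis j 1) $ i = (if j = \<sigma> i then -1 else 0)" if ij: "i \<in> uf t" "j \<in> uf t" for i j
  proof -
    obtain g where g: "has_degree ?t' (tmon t1 (axis (\<sigma> j) 1)) g" "\<And>i. i \<in> uf t \<Longrightarrow> g $ i = - axis j 1 $ i"
      using \<sigma>(3)[OF ij(2)] by auto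
    have XL: "tmon t1 (axis (\<sigma> j) 1) \<in> L"
      using t1(2) by (auto simp: cluster_monomials_in_def axis_nth intro!: exI[of _ "axis (\<sigma> j) 1"])
    obtain g0 where g0: "pointed ?t' g0 (tmon t1 (axis (\<sigma> j) 1))"
      using triangular_basis_pointed[OF tb XL] by blast
    \<comment> \<open>The shift only provides a degree; membership in \<open>L\<close> makes the
      variable pointed, which is what \<open>seed_transport\<close> requires.\<close>
    have "g0 = g"
      using t'.has_degree_unique[OF t'.pointed_has_degree[OF g0] g(1)] .
    then have "pointed t1 (trop_seq ks ?t' g) (tmon t1 (axis (\<sigma> j) 1))"
      using seed_transport[OF t xs ks(2) XL g0] by (simp add: ks(1))
    then have "trop_seq ks ?t' g = axis (\<sigma> j) 1"
      using t1.pointed_unique t1.pointed_tmon by blast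
    then have g_eq: "trop_bmat_seq (rev ks) (bmat t1) (axis (\<sigma> j) 1) = g"
      using trop_bmat_seq_rev[of ks "bmat ?t'" g] by (simp add: trop_seq_bmat bmat_mutate_seq[of ks ?t'] ks(1))
    \<comment> \<open>The backward run from \<open>t1\<close> returns \<open>g\<close>; relabelled
      by \<open>\<sigma>\<close> it becomes a run along \<open>ys\<close> starting at
      \<open>?t'\<close>, whose entry \<open>i\<close> is entry \<open>\<sigma> i\<close> of
      \<open>g\<close>.\<close>
    have "trop_bmat_seq (map \<sigma> ys) (bmat t1) (axis (\<sigma> j) 1) $ \<sigma> i = trop_bmat_seq ys (bmat ?t') (axis j 1) $ i"
    proof (rule trop_bmat_seq_equivariant[of \<sigma> "uf t"])
      show "inj_on \<sigma> (uf t)" using inj by (rule inj_on_subset) simp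
      show "axis (\<sigma> j) 1 $ \<sigma> i = (axis j 1 :: int ^ 'i) $ i" for i
        using inj by (simp add: axis_nth inj_eq)
    qed (fact ys_uf, erule \<sigma>(2), assumption, fact ij(1))
    then have "trop_bmat_seq ys (bmat ?t') (axis j 1) $ i = g $ \<sigma> i"
      by (simp add: ys g_eq)
    also have "\<dots> = (if j = \<sigma> i then -1 else 0)"
      using g(2)[of "\<sigma> i"] ij(1) permutes_in_image[OF \<sigma>(1)] by (auto simp: axis_nth)
    finally show ?thesis by (simp add: trop_seq_bmat)
  qed
  moreover have "trop_seq ys ?t' (axis j 1) = axis j 1" if "j \<notin> uf t" for j
    unfolding trop_seq_bmat by (rule trop_bmat_seq_axis) (use that ys_uf in auto)
  ultimately show thesis using that[of ys \<sigma>] ys_uf \<sigma>(1) by blast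
qed

lemma zv_subalgebra_mutate_seq: "zv_subalgebra (mutate_seq ks t) A = zv_subalgebra t A"
proof -
  have "zv_scale (mutate_seq ks t) = zv_scale t" by (simp add: fun_eq_iff zv_scale_def)
  then show ?thesis by (simp add: zv_subalgebra_def)
qed

subsection \<open>Products of cluster monomials with basis elements\<close>

text \<open>A single coefficient function on \<open>L\<close> carries the upper bounds, found in
  \<open>t'\<close>, and the lower bounds, found in \<open>t'[-1]\<close>. \<open>S\<close> and
  \<open>H\<close> may coincide.\<close>

lemma cluster_monomial_times_basis:
  fixes t :: "('i::finite, 'k::division_ring) qseed"
  assumes t: "quantum_torus t d" "common_triangular_basis t A L" "zv_subalgebra t A"
    and xs: "set xs \<subseteq> uf t" and m: "\<forall>i. 0 \<le> m $ i" and W: "W \<in> L"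
  obtains b S H and s h :: int where
    "finite {W. b W \<noteq> 0}" "{W. b W \<noteq> 0} \<subseteq> L" "S \<in> L" "H \<in> L"
    "tmon (mutate_seq xs t) m * W = (\<Sum>W | b W \<noteq> 0. coef t (b W) * W)"
    "b S = vpow s" "\<And>W. W \<noteq> S \<Longrightarrow> b W \<in> zv_le (s - 1)"
    "b H = vpow h" "\<And>W. W \<noteq> H \<Longrightarrow> b W \<in> zv_ge (h + 1)"
proof -
  obtain ys \<sigma> where ys: "set ys \<subseteq> uf t" and \<sigma>: "\<sigma> permutes uf t"
    and trop_uf: "\<And>i j. i \<in> uf t \<Longrightarrow> j \<in> uf t \<Longrightarrow>
      trop_seq ys (mutate_seq xs t) (axis j 1) $ i = (if j = \<sigma> i then -1 else 0)"
    and trop_fr: "\<And>j. j \<notin> uf t \<Longrightarrow> trop_seq ys (mutate_seq xs t) (axis j 1) = axis j 1"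
    using inverse_shift[OF t(1,2) xs] by metis
  define t' where "t' = mutate_seq xs t"
  define t'' where "t'' = mutate_seq ys t'"
  have t''_eq: "t'' = mutate_seq (xs @ ys) t" by (simp add: t''_def t'_def mutate_seq_append)
  have same: "uf t' = uf t" "uf t'' = uf t" "coef t' = coef t" "coef t'' = coef t" "vq t' = vq t" "vq t'' = vq t"
    by (simp_all add: t''_eq t'_def)
  have tb': "triangular_basis t' A L" and tb'': "triangular_basis t'' A L"
    using t(2) xs ys unfolding common_triangular_basis_def t''_eq t'_def by auto
  have qt': "quantum_torus t' d" and qt'': "quantum_torus t'' d"
    unfolding t''_eq t'_def using xs ys by (auto intro!: quantum_torus_mutate_seq t(1))
  have sub': "zv_subalgebra t' A" and sub'': "zv_subalgebra t'' A"
    using t(3) by (simp_all add: zv_subalgebra_mutate_seq t''_eq t'_def)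
  obtain Lg' where "triangular t' d A L Lg'"
    using triangular_basis_imp_triangular[OF qt' sub' tb'] .
  then interpret t': triangular t' d A L Lg' .
  obtain Lg'' where "triangular t'' d A L Lg''"
    using triangular_basis_imp_triangular[OF qt'' sub'' tb''] .
  then interpret t'': triangular t'' d A L Lg'' .
  define dg where "dg m = trop_seq ys t' m" for m
  have monL: "tmon t' n \<in> L" if "\<forall>i. 0 \<le> n $ i" for n
    using tb' that unfolding triangular_basis_def cluster_monomials_in_def by blast
  have I: "tmon t' n = Lg'' (dg n)" if n: "\<forall>i. 0 \<le> n $ i" for n
    using seed_transport[OF t(1,2) xs ys monL[OF n]] t'.pointed_tmon[of n]
    unfolding dg_def t''_def t'_def by (intro t''.L_pointedE[unfolded t''_def t'_def] monL[OF n, unfolded t'_def]) blast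
  have mult: "tmon t' n * tmon t' n' = vq t'' powi lam_form (lam t') n n' * tmon t' (n + n')" for n n'
    by (simp add: t'.tmon_mult same)
  \<comment> \<open>The tropical map is only piecewise linear; its additivity on nonnegative vectors
    is forced by products of cluster monomials of \<open>t'\<close> being again basis elements up to
    powers of \<open>v\<close>.\<close>
  have dg_add: "dg (n + n') = dg n + dg n'" if n: "\<forall>i. 0 \<le> n $ i" "\<forall>i. 0 \<le> n' $ i" for n n'
  proof -
    have "\<forall>i. 0 \<le> (n + n') $ i" using n by simp
    then have "Lg'' (dg n) * Lg'' (dg n') = vq t'' powi lam_form (lam t') n n' * Lg'' (dg (n + n'))"
      using mult[of n n'] by (simp add: I n)
    from t''.Lg_mult_Lg[OF this] show ?thesis by blast
  qed
  have dg_uf: "dg n $ i = - (n $ \<sigma> i)" if n: "\<forall>i. 0 \<le> n $ i" and i: "i \<in> uf t" for n i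
  proof -
    have dg0: "dg 0 = 0" using dg_add[of 0 0] by simp
    have "(\<forall>i. 0 \<le> n $ i) \<and> (\<forall>i\<in>uf t. dg n $ i = - (n $ \<sigma> i))"
    proof (rule int_vec_sum_induct)
      fix j
      have ax: "dg (axis j 1) $ i = - (axis j 1 $ \<sigma> i)" if "i \<in> uf t" for i
        using trop_uf[of i j] trop_fr[of j] that permutes_in_image[OF \<sigma>, of i]
        by (cases "j \<in> uf t") (auto simp: dg_def t'_def axis_nth)
      have "\<forall>i\<in>uf t. dg (int l *s axis j 1) $ i = - ((int l *s axis j 1) $ \<sigma> i)" for l
      proof (induction l)
        case (Suc l)
        have "dg (axis j 1 + int l *s axis j 1) = dg (axis j 1) + dg (int l *s axis j 1)"
          by (rule dg_add) (auto simp: axis_nth)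
        then show ?case
          using Suc ax by (simp add: vector_sadd_rdistrib)
      qed (simp add: dg0)
      from this[of "nat (n $ j)"] n
      show "(\<forall>i. 0 \<le> (n $ j *s axis j 1) $ i) \<and>
          (\<forall>i\<in>uf t. dg (n $ j *s axis j 1) $ i = - ((n $ j *s axis j 1) $ \<sigma> i))"
        by (simp add: axis_nth)
    qed (auto simp: dg0 dg_add)
    then show ?thesis using i by blast
  qed
  obtain g where g: "W = Lg' g" using W by (auto simp: t'.range_Lg)
  obtain g2 where g2: "W = Lg'' g2" using W by (auto simp: t''.range_Lg)
  let ?Z = "tmon t' m * W"
  have lead': "t'.lead ?Z (lam_form (lam t') m g) (g + m)"
    unfolding g using m by (intro t'.lead_tmon) auto
  have lead'': "t''.lead (W * tmon t' m) (lam_form (lam t'') g2 (dg m)) (g2 + dg m)"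
    unfolding g2
  proof (rule t''.lead_right_mult[where I = "tmon t'" and dg = dg and la = "lam_form (lam t')" and m = m])
    show "dg n $ k \<le> 0" if "\<forall>i. 0 \<le> n $ i" "k \<in> uf t''" for n k
      using that dg_uf[of n k] by (simp add: same)
    \<comment> \<open>The witness carries the negative parts of \<open>g\<close> through
      \<open>\<sigma>\<close>, so that entry \<open>i\<close> of its degree is - [- g_i]_+, which is
      at most g_i.\<close>
    show "\<exists>n. (\<forall>i. 0 \<le> n $ i) \<and> (\<forall>k\<in>uf t''. dg n $ k \<le> g $ k)" for g
      using dg_uf[of "\<chi> i. pos (- (g $ inv \<sigma> i))"]
      by (intro exI[of _ "\<chi> i. pos (- (g $ inv \<sigma> i))"])
        (auto simp: same permutes_inverses[OF \<sigma>])
  qed ((erule I) | rule mult | rule m)+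
  let ?s = "lam_form (lam t') m g" and ?u = "lam_form (lam t'') g2 (dg m)"
  have ZA: "?Z \<in> A" using lead' by (simp add: t'.lead_def)
  have coord: "t''.coord ?Z h = zv_bar (t''.coord (W * tmon t' m) h)" for h
    by (rule t''.coord_bar) (use monL[OF m] W in auto)
  obtain b where b: "finite {W. b W \<noteq> 0}" "{W. b W \<noteq> 0} \<subseteq> L"
    "?Z = (\<Sum>W | b W \<noteq> 0. coef t' (b W) * W)" "\<And>h. b (Lg' h) = t'.coord ?Z h"
    by (rule t'.sum_over_L[OF ZA]) blast
  obtain c where c: "finite {W. c W \<noteq> 0}" "{W. c W \<noteq> 0} \<subseteq> L"
    "?Z = (\<Sum>W | c W \<noteq> 0. coef t'' (c W) * W)" "\<And>h. c (Lg'' h) = t''.coord ?Z h"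
    by (rule t''.sum_over_L[OF ZA]) blast
  \<comment> \<open>Same element and same basis: the expansions made in \<open>t'\<close> and in
    \<open>t''\<close> have equal coefficients although the degrees differ.\<close>
  have bc: "b = c"
  proof (rule sum_over_basis_unique[OF t'.module_zv_scale t'.basis b(1,2) c(1,2)])
    show "(\<Sum>W | b W \<noteq> 0. coef t' (b W) * W) = (\<Sum>W | c W \<noteq> 0. coef t' (c W) * W)"
      unfolding same by (rule trans[OF b(3)[unfolded same, symmetric] c(3)[unfolded same]])
  qed
  show thesis
  proof (rule that[of b "Lg' (g + m)" "Lg'' (g2 + dg m)" ?s "- ?u"])
    show "finite {W. b W \<noteq> 0}" "{W. b W \<noteq> 0} \<subseteq> L" by fact+
    show "tmon (mutate_seq xs t) m * W = (\<Sum>W | b W \<noteq> 0. coef t (b W) * W)"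
      by (rule b(3)[unfolded same(3), unfolded t'_def])
    show "b (Lg' (g + m)) = vpow ?s"
      using lead' by (simp add: b(4) t'.lead_def)
    show "b U \<in> zv_le (?s - 1)" if "U \<noteq> Lg' (g + m)" for U
    proof (cases "U \<in> L")
      case True
      then obtain h where h: "U = Lg' h" by (auto simp: t'.range_Lg)
      then have "h \<noteq> g + m" using that by auto
      then show ?thesis
        using lead' unfolding h b(4) t'.lead_def by (metis zv_le_0)
    next
      case False
      then have "b U = 0" using b(2) by auto
      then show ?thesis by simp
    qed
    \<comment> \<open>The exponent \<open>?u\<close> belongs to \<open>W * tmon t' m\<close>; bar,
      used to reverse the product, changes its sign.\<close>
    show "b (Lg'' (g2 + dg m)) = vpow (- ?u)"
      using lead'' by (simp add: bc c(4) coord t''.lead_def)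
    show "b U \<in> zv_ge (- ?u + 1)" if "U \<noteq> Lg'' (g2 + dg m)" for U
    proof (cases "U \<in> L")
      case True
      then obtain h where h: "U = Lg'' h" by (auto simp: t''.range_Lg)
      then have "h \<noteq> g2 + dg m" using that by auto
      then have "t''.coord (W * tmon t' m) h \<in> zv_le (?u - 1)"
        using lead'' unfolding t''.lead_def by (metis zv_le_0)
      from zv_bar_le[OF this] show ?thesis
        unfolding h bc c(4) coord by simp
    next
      case False
      then have "b U = 0" using b(2) by auto
      then show ?thesis by (simp add: zv_ge_iff)
    qed
  qed simp_all
qed

section \<open>Localized monomials, and the alternative of equal or distinct extreme terms\<close>

theorem theorem1p3:
  fixes t :: "('i::finite, 'k::division_ring) qseed"
    and A L :: "'k set"
    and V R :: 'k
  assumes "quantum_seed t"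
    and "injective_reachable t"
    and "zv_subalgebra t A"
    and "A \<subseteq> upper_cluster_algebra t"
    and "common_triangular_basis t A L"
    and "V \<in> L"
    and "R \<in> localized_cluster_monomials t"
  shows "(\<exists>n::int. \<exists>W\<in>L. R * V = vq t powi n * W) \<or>
    (\<exists>(s::int) (h::int) S H J (b :: 'k \<Rightarrow> zv).
        h < s \<and> S \<in> L \<and> H \<in> L \<and> finite J \<and> J \<subseteq> L \<and>
        S \<noteq> H \<and> S \<notin> J \<and> H \<notin> J \<and>
        (\<forall>W\<in>J. b W \<in> zv_ge (h + 1) \<inter> zv_le (s - 1)) \<and>
        R * V = vq t powi s * S + (\<Sum>W\<in>J. coef t (b W) * W) + vq t powi h * H)"
proof -
  obtain d where qt: "quantum_torus t d"
    using quantum_seed_torus[OF assms(1)] by blast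
  interpret t: quantum_torus t d by (rule qt)
  obtain xs m where xs: "set xs \<subseteq> uf t" and R: "R = tmon (mutate_seq xs t) m"
    and m: "\<And>i. i \<in> uf t \<Longrightarrow> 0 \<le> m $ i"
    using assms(7) unfolding localized_cluster_monomials_def Delta_plus_def by blast
  let ?t' = "mutate_seq xs t"
  have "triangular_basis ?t' A L"
    using assms(5) xs unfolding common_triangular_basis_def by blast
  moreover have "zv_subalgebra ?t' A"
    using assms(3) by (simp add: zv_subalgebra_mutate_seq)
  ultimately obtain Lg where "triangular ?t' d A L Lg"
    using triangular_basis_imp_triangular quantum_torus_mutate_seq[OF qt xs] by metis
  then interpret t': triangular ?t' d A L Lg .
  \<comment> \<open>The negative entries of \<open>m\<close> are all frozen, so
    \<open>tmon ?t' (- c)\<close> merely shifts \<open>V\<close> within \<open>L\<close> and an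
    honest cluster monomial remains.\<close>
  define mp c where "mp = (\<chi> i. pos (m $ i))" and "c = (\<chi> i. pos (- (m $ i)))"
  have mpc: "m = mp + (- c)" by (auto simp: vec_eq_iff mp_def c_def)
  have "(- c) $ k = 0" if "k \<in> uf ?t'" for k
    using m[of k] that by (simp add: c_def)
  then have "t'.shifting (- c)" by (rule t'.shifting_frozen)
  moreover obtain g where g: "V = Lg g" using assms(6) by (auto simp: t'.range_Lg)
  ultimately have cV: "tmon ?t' (- c) * V = vq t powi lam_form (lam ?t') (- c) g * Lg (g + - c)"
    by (simp add: t'.shifting_def)
  obtain n where n: "R * V = vq t powi n * (tmon ?t' mp * Lg (g + - c))"
  proof
    let ?n = "- lam_form (lam ?t') mp (- c)"
    have cent: "tmon ?t' mp * (vq t powi j * z) = vq t powi j * (tmon ?t' mp * z)" for j z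
      by (metis t.powi_central mult.assoc)
    have "R = vq t powi ?n * (tmon ?t' mp * tmon ?t' (- c))"
      unfolding R by (subst mpc) (simp add: t'.tmon_mult flip: mult.assoc t.powi_add)
    then have "R * V = vq t powi ?n * (tmon ?t' mp * (tmon ?t' (- c) * V))"
      by (simp add: mult.assoc)
    also have "\<dots> = vq t powi ?n * (vq t powi lam_form (lam ?t') (- c) g * (tmon ?t' mp * Lg (g + - c)))"
      by (simp only: cV cent)
    finally show "R * V = vq t powi (?n + lam_form (lam ?t') (- c) g) * (tmon ?t' mp * Lg (g + - c))"
      by (simp only: t.powi_add mult.assoc)
  qed
  have "\<forall>i. 0 \<le> mp $ i" by (simp add: mp_def)
  note times = cluster_monomial_times_basis[OF qt assms(5,3) xs this t'.Lg_in_L[of "g + - c"]]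
  obtain b S H and s h :: int where b: "finite {W. b W \<noteq> 0}" "{W. b W \<noteq> 0} \<subseteq> L" "S \<in> L" "H \<in> L"
    "tmon ?t' mp * Lg (g + - c) = (\<Sum>W | b W \<noteq> 0. coef t (b W) * W)"
    and S: "b S = vpow s" "\<And>W. W \<noteq> S \<Longrightarrow> b W \<in> zv_le (s - 1)"
    and H: "b H = vpow h" "\<And>W. W \<noteq> H \<Longrightarrow> b W \<in> zv_ge (h + 1)"
    by (rule times) blast
  have RV: "R * V = (\<Sum>W | b W \<noteq> 0. coef t (vpow n * b W) * W)"
    unfolding n b(5) by (simp add: sum_distrib_left t.coef_mult mult.assoc)
  show ?thesis
  proof (cases "S = H")
    case True
    \<comment> \<open>Once \<open>s = h\<close>, every other coefficient lies in
      \<open>v^(s-1) \<int>[v^-1]\<close> and in \<open>v^(s+1) \<int>[v]\<close>, hence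
      vanishes.\<close>
    have "s = h"
      using S(1) H(1) True by (metis order_antisym zv_le_vpow order_refl)
    have "b W = 0" if "W \<noteq> S" for W
      using S(2)[OF that] H(2)[of W] that True \<open>s = h\<close> by (intro zv_le_ge_eq_0) auto
    then have "{W. b W \<noteq> 0} = {S}" using S(1) by auto
    then have "R * V = vq t powi (n + s) * S"
      unfolding RV by (simp add: S(1) vpow_mult)
    then show ?thesis using b(3) by blast
  next
    case False
    let ?J = "{W. b W \<noteq> 0} - {S} - {H}"
    \<comment> \<open>For \<open>S \<noteq> H\<close> the coefficient \<open>v^s\<close> of
      \<open>S\<close> obeys the lower bound \<open>h + 1\<close> that holds away from
      \<open>H\<close>.\<close>
    have hs: "h < s" using H(2)[OF False] by (simp add: S(1))
    have "R * V = coef t (vpow n * b S) * S + (\<Sum>W\<in>{W. b W \<noteq> 0} - {S}. coef t (vpow n * b W) * W)"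
      unfolding RV using S(1) b(1) by (intro sum.remove) auto
    also have "(\<Sum>W\<in>{W. b W \<noteq> 0} - {S}. coef t (vpow n * b W) * W) =
      coef t (vpow n * b H) * H + (\<Sum>W\<in>?J. coef t (vpow n * b W) * W)"
      using H(1) b(1) False by (intro sum.remove) auto
    finally have "R * V = vq t powi (n + s) * S + (\<Sum>W\<in>?J. coef t (vpow n * b W) * W) + vq t powi (n + h) * H"
      by (simp add: S(1) H(1) vpow_mult add_ac)
    moreover have "vpow n * b W \<in> zv_ge (n + h + 1) \<inter> zv_le (n + s - 1)" if "W \<in> ?J" for W
      using zv_le_mult[of "vpow n" n "b W" "s - 1"] zv_ge_mult[of "vpow n" n "b W" "h + 1"] S(2)[of W] H(2)[of W] that
      by (simp add: algebra_simps)
    ultimately show ?thesis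
      using hs b False
      by (intro disjI2 exI[of _ "n + s"] exI[of _ "n + h"] exI[of _ S] exI[of _ H] exI[of _ ?J]
          exI[of _ "\<lambda>W. vpow n * b W"]) auto
  qed
qed

end
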